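(* Let $X$ be a labelled regular cell complex with labels in $\mathbb N^n$. Then $$\mathbb F^{(X,X_U)}={}^{*}\varprojlim_t\ \mathbb F^{t}(X)$$ as $\mathbb Z^n$-graded chain complexes of $S$-modules, where the inverse system $\{\mathbb F^t(X)\}_{t\in\mathbb N}$ has transition maps $\varphi_{t\cdot\mathbf 1,\,t'\cdot\mathbf 1}$ for $t\ge t'\ge0$.
   Context: $k$ is a field, $n\ge 2$, $S=k[x_1,\ldots,x_n]$, $\mathbb Z^n$-graded; $\preceq$ is the coordinatewise order on $\mathbb Z^n$; $\mathbf 1=(1,\ldots,1)$; $N[\mathbf a]_{\mathbf b}=N_{\mathbf a+\mathbf b}$. A labelled regular cell complex $X$ is a finite regular cell complex whose vertices $v$ carry labels $\mathbf a_v\in\mathbb Z^n$, each nonempty face $F$ being labelled by the join (componentwise maximum) $\mathbf a_F=\bigvee_{v\in F}\mathbf a_v$, together with an incidence function $\varepsilon(F,G)\in\{1,0,-1\}$ defining the cellular boundary map over $k$. With $m_F=x^{\mathbf a_F}$, $\mathbb F_X=\bigoplus_{F\ne\emptyset}SF$ with $F$ in $\mathbb Z^n$-degree $\mathbf a_F$, homological degree $\dim F$, and $\partial F=\sum_{G\neq\emptyset}\varepsilon(F,G)\frac{m_F}{m_G}G$. For a subcomplex $Y$ with induced labels, $\mathbb F^{(X,Y)}=\underline{\mathrm{Hom}}_S(\mathbb F_X/\mathbb F_Y,S)$, the dual basis element $F^*$ lying in $\mathbb Z^n$-degree $-\mathbf a_F$ and homological degree $-\dim F$. $X_U=\{F\in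 X\mid\mathbf a_F\not\succeq\mathbf 1\}$. For $\mathbf b\succeq\mathbf 0$ let $f_{\mathbf b}:\mathbb Z^n\to\mathbb Z^n$ be given by $f_{\mathbf b}(\mathbf c)_i=c_i-b_i$ if $c_i\le0$ and $f_{\mathbf b}(\mathbf c)_i=c_i$ if $c_i\ge1$; put $f_{\mathbf b}(x^{\mathbf c})=x^{f_{\mathbf b}(\mathbf c)}$. The map $f_{\mathbf b}$ preserves joins, so applying it to all labels of $X$ gives a labelled cell complex $f_{\mathbf b}(X)$. Let $\mathbb F_{\mathbf b}(X)$ be the complex $\mathbb F_{f_{\mathbf b}(X)}$ augmented by the summand $S[\mathbf b]$ in homological degree $-1$, corresponding to the empty face $\emptyset$ (given label $\mathbf a_\emptyset=\mathbf 0$, so that $f_{\mathbf b}(\mathbf a_\emptyset)=-\mathbf b$) with the usual augmentation (vertex $v\mapsto \frac{f_{\mathbf b}(m_v)}{f_{\mathbf b}(m_\emptyset)}\,\emptyset$). Let $\mathbb F^{\mathbf b}(X)=\underline{\mathrm{Hom}}_S(\mathbb F_{\mathbf b}(X),S)$, with dual basis element $F^{\mathbf b}$ of $\mathbb Z^n$-degree $-f_{\mathbf b}(\mathbf a_F)$ for each face $F$ (including $\emptyset$). For $\mathbf b\succeq\mathbf b'\succeq\mathbf 0$, $\varphi_{\mathbf b,\mathbf b'}:\mathbb F^{\mathbf b}(X)\to\mathbb F^{\mathbf b'}(X)$ is the injective degree-$\mathbf 0$ chain map $F^{\mathbf b}\mapsto\frac{m_F}{f_{\mathbf b-\mathbf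 b'}(m_F)}F^{\mathbf b'}$; these maps form an inverse system. Put $\mathbb F^t(X)=\mathbb F^{t\cdot\mathbf 1}(X)$. The symbol ${}^*\varprojlim$ is the inverse limit in the category of $\mathbb Z^n$-graded objects and degree-zero maps: ${}^*\varprojlim_t\mathbb F^t(X)=\bigoplus_{\mathbf c\in\mathbb Z^n}\varprojlim_t\mathbb F^t(X)_{\mathbf c}$, the limits on the right being of complexes of $k$-vector spaces. *)

theory Defs
  imports
    "HOL-Library.Poly_Mapping"
    "HOL-Library.Function_Algebras"
    "HOL-Analysis.Abstract_Euclidean_Space"
    "HOL-Algebra.Module"
    "HOL-Algebra.AbelCoset"
begin

section \<open>The polynomial ring and multigraded modules\<close>

text \<open>Multidegrees are functions \<open>'n \<Rightarrow> int\<close> on a finite type with \<open>CARD('n) = n\<close>; the order, sums,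
  differences and the constants \<open>0\<close> and \<open>1\<close> are the pointwise ones of the library.\<close>

type_synonym ('n, 'k) mpoly = "('n \<Rightarrow>\<^sub>0 nat) \<Rightarrow>\<^sub>0 'k"

definition polyring :: "('n, 'k::field) mpoly ring" where
  "polyring = \<lparr> carrier = UNIV, monoid.mult = (*), one = 1, zero = 0, add = (+) \<rparr>"

definition poly_comp :: "('n \<Rightarrow> int) \<Rightarrow> ('n, 'k::field) mpoly set" where
  "poly_comp c = {p. \<forall>m \<in> Poly_Mapping.keys p. \<forall>i. int (Poly_Mapping.lookup m i) = c i}"

text \<open>\<open>x\<^sup>e\<close> for \<open>e \<ge> 0\<close>. It is only used for quotients of (Laurent) monomials that lie in \<open>S\<close>, or with
  coefficient zero, so the truncation by \<open>nat\<close> never matters.\<close>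

definition monomial_of :: "('n::finite \<Rightarrow> int) \<Rightarrow> ('n, 'k::field) mpoly" where
  "monomial_of e = Poly_Mapping.single (Abs_poly_mapping (\<lambda>i. nat (e i))) 1"

text \<open>The library's module records extend ring records; their fields \<open>mult\<close> and \<open>one\<close> play no role
  and are left undefined in the constructions below.\<close>

record ('s, 'm, 'n) graded_module = "('s, 'm) module" +
  hcomp :: "('n \<Rightarrow> int) \<Rightarrow> 'm set"

type_synonym ('n, 'k, 'm) gmod = "(('n, 'k) mpoly, 'm, 'n) graded_module"

definition is_graded_module :: "('n, 'k::field, 'm) gmod \<Rightarrow> bool" where
  "is_graded_module M \<longleftrightarrow>
     Module.module polyring M \<and>
     (\<forall>c. additive_subgroup (hcomp M c) M) \<and>
     (\<forall>c d. \<forall>p \<in> poly_comp d. \<forall>x \<in> hcomp M c. p \<odot>\<^bsub>M\<^esub> x \<in> hcomp M (c + d)) \<and>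
     (\<forall>x \<in> carrier M. \<exists>!g. (\<forall>c. g c \<in> hcomp M c) \<and> finite {c. g c \<noteq> \<zero>\<^bsub>M\<^esub>} \<and>
        x = finsum M g {c. g c \<noteq> \<zero>\<^bsub>M\<^esub>})"

definition linear_map :: "('n, 'k::field, 'm) gmod \<Rightarrow> ('n, 'k, 'l) gmod \<Rightarrow> ('m \<Rightarrow> 'l) \<Rightarrow> bool" where
  "linear_map M N f \<longleftrightarrow> f \<in> carrier M \<rightarrow> carrier N \<and>
     (\<forall>x \<in> carrier M. \<forall>y \<in> carrier M. f (x \<oplus>\<^bsub>M\<^esub> y) = f x \<oplus>\<^bsub>N\<^esub> f y) \<and>
     (\<forall>s. \<forall>x \<in> carrier M. f (s \<odot>\<^bsub>M\<^esub> x) = s \<odot>\<^bsub>N\<^esub> f x)"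

definition degree_zero_map :: "('n, 'k::field, 'm) gmod \<Rightarrow> ('n, 'k, 'l) gmod \<Rightarrow> ('m \<Rightarrow> 'l) \<Rightarrow> bool" where
  "degree_zero_map M N f \<longleftrightarrow> linear_map M N f \<and> (\<forall>c. f ` hcomp M c \<subseteq> hcomp N c)"

section \<open>Graded chain complexes\<close>

record ('s, 'm, 'n) gcomplex =
  chain :: "int \<Rightarrow> ('s, 'm, 'n) graded_module"
  bdry :: "int \<Rightarrow> 'm \<Rightarrow> 'm"

type_synonym ('n, 'k, 'm) gcpx = "(('n, 'k) mpoly, 'm, 'n) gcomplex"

definition is_graded_complex :: "('n, 'k::field, 'm) gcpx \<Rightarrow> bool" where
  "is_graded_complex C \<longleftrightarrow>
     (\<forall>i. is_graded_module (chain C i)) \<and>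
     (\<forall>i. degree_zero_map (chain C i) (chain C (i - 1)) (bdry C i)) \<and>
     (\<forall>i. \<forall>x \<in> carrier (chain C i). bdry C (i - 1) (bdry C i x) = \<zero>\<^bsub>chain C (i - 2)\<^esub>)"

definition graded_complex_iso ::
    "('n, 'k::field, 'm) gcpx \<Rightarrow> ('n, 'k, 'l) gcpx \<Rightarrow> (int \<Rightarrow> 'm \<Rightarrow> 'l) \<Rightarrow> bool" where
  "graded_complex_iso C D \<phi> \<longleftrightarrow>
     is_graded_complex C \<and> is_graded_complex D \<and>
     (\<forall>i. degree_zero_map (chain C i) (chain D i) (\<phi> i) \<and>
          bij_betw (\<phi> i) (carrier (chain C i)) (carrier (chain D i)) \<and>
          (\<forall>x \<in> carrier (chain C i). \<phi> (i - 1) (bdry C i x) = bdry D i (\<phi> i x)))"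

text \<open>The quotient of a complex by a subcomplex, with cosets as elements.\<close>

definition quotient_module :: "('n, 'k::field, 'm) gmod \<Rightarrow> ('n, 'k, 'm) gmod \<Rightarrow> ('n, 'k, 'm set) gmod" where
  "quotient_module M N =
     \<lparr> carrier = a_rcosets\<^bsub>M\<^esub> (carrier N), monoid.mult = undefined, one = undefined,
       zero = carrier N, add = (<+>\<^bsub>M\<^esub>),
       module.smult = (\<lambda>s A. \<Union>x\<in>A. carrier N +>\<^bsub>M\<^esub> (s \<odot>\<^bsub>M\<^esub> x)),
       hcomp = (\<lambda>c. (\<lambda>x. carrier N +>\<^bsub>M\<^esub> x) ` hcomp M c) \<rparr>"

definition quotient_complex :: "('n, 'k::field, 'm) gcpx \<Rightarrow> ('n, 'k, 'm) gcpx \<Rightarrow> ('n, 'k, 'm set) gcpx" where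
  "quotient_complex C D =
     \<lparr> chain = (\<lambda>i. quotient_module (chain C i) (chain D i)),
       bdry = (\<lambda>i A. \<Union>x\<in>A. carrier (chain D (i - 1)) +>\<^bsub>chain C (i - 1)\<^esub> bdry C i x) \<rparr>"

text \<open>The graded dual: \<open>homogeneous_functionals M c\<close> are the \<open>S\<close>-linear maps \<open>M \<rightarrow> S\<close> of degree \<open>c\<close>, and
  the graded \<open>Hom\<close> is the internal direct sum of these inside all functionals. Functionals are
  extensional on the carrier so that equality of functions is equality of functionals.\<close>

definition homogeneous_functionals ::
    "('n, 'k::field, 'm) gmod \<Rightarrow> ('n \<Rightarrow> int) \<Rightarrow> ('m \<Rightarrow> ('n, 'k) mpoly) set" where
  "homogeneous_functionals M c = {f \<in> extensional (carrier M).
     (\<forall>x \<in> carrier M. \<forall>y \<in> carrier M. f (x \<oplus>\<^bsub>M\<^esub> y) = f x + f y) \<and>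
     (\<forall>s. \<forall>x \<in> carrier M. f (s \<odot>\<^bsub>M\<^esub> x) = s * f x) \<and>
     (\<forall>d. \<forall>x \<in> hcomp M d. f x \<in> poly_comp (c + d))}"

definition dual_module :: "('n, 'k::field, 'm) gmod \<Rightarrow> ('n, 'k, 'm \<Rightarrow> ('n, 'k) mpoly) gmod" where
  "dual_module M =
     \<lparr> carrier = {f. \<exists>A h. finite A \<and> (\<forall>c \<in> A. h c \<in> homogeneous_functionals M c) \<and>
                        f = (\<lambda>x \<in> carrier M. \<Sum>c\<in>A. h c x)},
       monoid.mult = undefined, one = undefined,
       zero = (\<lambda>x \<in> carrier M. 0), add = (\<lambda>f g. \<lambda>x \<in> carrier M. f x + g x),
       module.smult = (\<lambda>s f. \<lambda>x \<in> carrier M. s * f x),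
       hcomp = homogeneous_functionals M \<rparr>"

text \<open>The dual of \<open>C\<^sub>i\<close> sits in homological degree \<open>-i\<close>; the differential is precomposition
  (without signs).\<close>

definition dual_complex :: "('n, 'k::field, 'm) gcpx \<Rightarrow> ('n, 'k, 'm \<Rightarrow> ('n, 'k) mpoly) gcpx" where
  "dual_complex C =
     \<lparr> chain = (\<lambda>i. dual_module (chain C (- i))),
       bdry = (\<lambda>i f. \<lambda>x \<in> carrier (chain C (1 - i)). f (bdry C (1 - i) x)) \<rparr>"

text \<open>The graded inverse limit of a system \<open>M\<^sub>t\<close> with maps \<open>\<phi> t t' : M\<^sub>t \<rightarrow> M\<^sub>t'\<close> for \<open>t \<ge> t'\<close>:
  \<open>limit_comp M \<phi> c\<close> is the inverse limit of the vector spaces \<open>(M\<^sub>t)\<^sub>c\<close>, as compatible sequences,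
  and the module is the direct sum of these over all \<open>c\<close>, taken inside the product of the \<open>M\<^sub>t\<close>
  (where the sum is direct, because it is so in each \<open>M\<^sub>t\<close>).\<close>

definition limit_comp ::
    "(nat \<Rightarrow> ('n, 'k::field, 'm) gmod) \<Rightarrow> (nat \<Rightarrow> nat \<Rightarrow> 'm \<Rightarrow> 'm) \<Rightarrow> ('n \<Rightarrow> int) \<Rightarrow> (nat \<Rightarrow> 'm) set" where
  "limit_comp M \<phi> c = {s. (\<forall>t. s t \<in> hcomp (M t) c) \<and> (\<forall>t t'. t' \<le> t \<longrightarrow> \<phi> t t' (s t) = s t')}"

definition limit_module ::
    "(nat \<Rightarrow> ('n, 'k::field, 'm) gmod) \<Rightarrow> (nat \<Rightarrow> nat \<Rightarrow> 'm \<Rightarrow> 'm) \<Rightarrow> ('n, 'k, nat \<Rightarrow> 'm) gmod" where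
  "limit_module M \<phi> =
     \<lparr> carrier = {s. \<exists>A h. finite A \<and> (\<forall>c \<in> A. h c \<in> limit_comp M \<phi> c) \<and>
                        s = (\<lambda>t. finsum (M t) (\<lambda>c. h c t) A)},
       monoid.mult = undefined, one = undefined,
       zero = (\<lambda>t. \<zero>\<^bsub>M t\<^esub>), add = (\<lambda>s s'. \<lambda>t. s t \<oplus>\<^bsub>M t\<^esub> s' t),
       module.smult = (\<lambda>p s. \<lambda>t. p \<odot>\<^bsub>M t\<^esub> s t),
       hcomp = limit_comp M \<phi> \<rparr>"

definition limit_complex ::
    "(nat \<Rightarrow> ('n, 'k::field, 'm) gcpx) \<Rightarrow> (nat \<Rightarrow> nat \<Rightarrow> int \<Rightarrow> 'm \<Rightarrow> 'm) \<Rightarrow> ('n, 'k, nat \<Rightarrow> 'm) gcpx" where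
  "limit_complex C \<phi> =
     \<lparr> chain = (\<lambda>i. limit_module (\<lambda>t. chain (C t) i) (\<lambda>t t'. \<phi> t t' i)),
       bdry = (\<lambda>i s. \<lambda>t. bdry (C t) i (s t)) \<rparr>"

section \<open>Labelled regular cell complexes\<close>

text \<open>Faces are the open cells together with the empty face, which is literally the empty set.
  Only the values of \<open>vlabel\<close> at vertices (faces of dimension 0) matter.\<close>

record ('p, 'n) cell_complex =
  space :: "'p topology"
  faces :: "'p set set"
  fdim :: "'p set \<Rightarrow> int"
  vlabel :: "'p set \<Rightarrow> 'n \<Rightarrow> int"
  incidence :: "'p set \<Rightarrow> 'p set \<Rightarrow> int"

definition closed_ball_space :: "nat \<Rightarrow> (nat \<Rightarrow> real) topology" where
  "closed_ball_space d = subtopology (Euclidean_space d) {x. (\<Sum>i<d. (x i)\<^sup>2) \<le> 1}"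

definition open_ball_set :: "nat \<Rightarrow> (nat \<Rightarrow> real) set" where
  "open_ball_set d = {x \<in> topspace (Euclidean_space d). (\<Sum>i<d. (x i)\<^sup>2) < 1}"

text \<open>Each closed cell is a closed ball whose interior is the open cell and whose boundary is a union
  of cells of smaller dimension.\<close>

definition regular_cell_complex :: "('p, 'n) cell_complex \<Rightarrow> bool" where
  "regular_cell_complex X \<longleftrightarrow>
     Hausdorff_space (space X) \<and> finite (faces X) \<and>
     {} \<in> faces X \<and> fdim X {} = -1 \<and>
     topspace (space X) = \<Union> (faces X) \<and> pairwise disjnt (faces X) \<and>
     (\<forall>F \<in> faces X - {{}}.
        (\<exists>d h. fdim X F = int d \<and>
           homeomorphic_map (closed_ball_space d) (subtopology (space X) (space X closure_of F)) h \<and>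
           h ` open_ball_set d = F) \<and>
        space X closure_of F - F = \<Union> {G \<in> faces X. G \<subseteq> space X closure_of F \<and> fdim X G < fdim X F})"

definition face_of :: "('p, 'n) cell_complex \<Rightarrow> 'p set \<Rightarrow> 'p set \<Rightarrow> bool" where
  "face_of X G F \<longleftrightarrow> G \<in> faces X \<and> F \<in> faces X \<and> G \<subseteq> space X closure_of F"

text \<open>In the last condition at most two summands are nonzero: those for the two faces strictly
  between \<open>H\<close> and \<open>F\<close>.\<close>

definition incidence_function :: "('p, 'n) cell_complex \<Rightarrow> bool" where
  "incidence_function X \<longleftrightarrow>
     (\<forall>F \<in> faces X. \<forall>G \<in> faces X. incidence X F G \<in> {1, 0, -1} \<and>
        (incidence X F G \<noteq> 0 \<longleftrightarrow> face_of X G F \<and> fdim X G = fdim X F - 1)) \<and>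
     (\<forall>v \<in> faces X. fdim X v = 0 \<longrightarrow> incidence X v {} = 1) \<and>
     (\<forall>F \<in> faces X. \<forall>H \<in> faces X. fdim X H = fdim X F - 2 \<longrightarrow>
        (\<Sum>G \<in> faces X. incidence X F G * incidence X G H) = 0)"

definition labelled_regular_cell_complex :: "('p, 'n) cell_complex \<Rightarrow> bool" where
  "labelled_regular_cell_complex X \<longleftrightarrow> regular_cell_complex X \<and> incidence_function X"

definition label :: "('p, 'n) cell_complex \<Rightarrow> 'p set \<Rightarrow> 'n \<Rightarrow> int" where
  "label X F = (if F = {} then 0
     else (\<lambda>i. Max ((\<lambda>v. vlabel X v i) ` {v. face_of X v F \<and> fdim X v = 0})))"

section \<open>Cellular complexes\<close>

text \<open>The free module with the faces \<open>F \<in> B\<close> of dimension \<open>i\<close> as basis, \<open>F\<close> in multidegree \<open>l F\<close>;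
  its elements are coefficient functions.\<close>

definition face_module ::
    "('p, 'n::finite) cell_complex \<Rightarrow> 'p set set \<Rightarrow> ('p set \<Rightarrow> 'n \<Rightarrow> int) \<Rightarrow> int \<Rightarrow>
     ('n, 'k::field, 'p set \<Rightarrow> ('n, 'k) mpoly) gmod" where
  "face_module X B l i =
     \<lparr> carrier = {g. \<forall>F. g F \<noteq> 0 \<longrightarrow> F \<in> B \<and> fdim X F = i},
       monoid.mult = undefined, one = undefined,
       zero = 0, add = (+), module.smult = (\<lambda>s g F. s * g F),
       hcomp = (\<lambda>c. {g. (\<forall>F. g F \<noteq> 0 \<longrightarrow> F \<in> B \<and> fdim X F = i) \<and>
                        (\<forall>F. g F \<in> poly_comp (c - l F))}) \<rparr>"

definition face_complex ::
    "('p, 'n::finite) cell_complex \<Rightarrow> 'p set set \<Rightarrow> ('p set \<Rightarrow> 'n \<Rightarrow> int) \<Rightarrow>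
     ('n, 'k::field, 'p set \<Rightarrow> ('n, 'k) mpoly) gcpx" where
  "face_complex X B l =
     \<lparr> chain = face_module X B l,
       bdry = (\<lambda>i g G. if G \<in> B
          then \<Sum>F \<in> {F \<in> B. fdim X F = i}. g F * (of_int (incidence X F G) * monomial_of (l F - l G))
          else 0) \<rparr>"

definition cellular_complex ::
    "('p, 'n::finite) cell_complex \<Rightarrow> 'p set set \<Rightarrow> ('n, 'k::field, 'p set \<Rightarrow> ('n, 'k) mpoly) gcpx" where
  "cellular_complex X Y = face_complex X (Y - {{}}) (label X)"

text \<open>\<open>Y\<close> is the set of faces of a subcomplex of \<open>X\<close>.\<close>

definition relative_dual_complex ::
    "('p, 'n::finite) cell_complex \<Rightarrow> 'p set set \<Rightarrow>
     ('n, 'k::field, ('p set \<Rightarrow> ('n, 'k) mpoly) set \<Rightarrow> ('n, 'k) mpoly) gcpx" where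
  "relative_dual_complex X Y =
     dual_complex (quotient_complex (cellular_complex X (faces X)) (cellular_complex X Y))"

definition X_U :: "('p, 'n) cell_complex \<Rightarrow> 'p set set" where
  "X_U X = {F \<in> faces X. \<not> 1 \<le> label X F}"

definition shift_label :: "('n \<Rightarrow> int) \<Rightarrow> ('n \<Rightarrow> int) \<Rightarrow> 'n \<Rightarrow> int" where
  "shift_label b c = (\<lambda>i. if c i \<le> 0 then c i - b i else c i)"

text \<open>The empty face belongs to the basis here, in degree \<open>shift_label b 0 = - b\<close>; the augmentation
  comes from \<open>incidence X v {} = 1\<close>.\<close>

definition shifted_complex ::
    "('n::finite \<Rightarrow> int) \<Rightarrow> ('p, 'n) cell_complex \<Rightarrow> ('n, 'k::field, 'p set \<Rightarrow> ('n, 'k) mpoly) gcpx" where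
  "shifted_complex b X = face_complex X (faces X) (\<lambda>F. shift_label b (label X F))"

definition shifted_dual ::
    "('n::finite \<Rightarrow> int) \<Rightarrow> ('p, 'n) cell_complex \<Rightarrow>
     ('n, 'k::field, ('p set \<Rightarrow> ('n, 'k) mpoly) \<Rightarrow> ('n, 'k) mpoly) gcpx" where
  "shifted_dual b X = dual_complex (shifted_complex b X)"

definition face_vector :: "'p set \<Rightarrow> 'p set \<Rightarrow> ('n, 'k::field) mpoly" where
  "face_vector F = (\<lambda>G. if G = F then 1 else 0)"

text \<open>The dual basis element \<open>F\<^sup>b\<close>.\<close>

definition shifted_dual_basis ::
    "('n::finite \<Rightarrow> int) \<Rightarrow> ('p, 'n) cell_complex \<Rightarrow> 'p set \<Rightarrow>
     ('p set \<Rightarrow> ('n, 'k::field) mpoly) \<Rightarrow> ('n, 'k) mpoly" where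
  "shifted_dual_basis b X F = (\<lambda>g \<in> carrier (chain (shifted_complex b X) (fdim X F)). g F)"

text \<open>The dual basis element \<open>F\<^sup>*\<close>: for \<open>F \<notin> Y\<close> all representatives of a coset have the same
  coefficient at \<open>F\<close>.\<close>

definition relative_dual_basis ::
    "('p, 'n::finite) cell_complex \<Rightarrow> 'p set set \<Rightarrow> 'p set \<Rightarrow>
     ('p set \<Rightarrow> ('n, 'k::field) mpoly) set \<Rightarrow> ('n, 'k) mpoly" where
  "relative_dual_basis X Y F =
     (\<lambda>A \<in> carrier (chain (quotient_complex (cellular_complex X (faces X)) (cellular_complex X Y)) (fdim X F)).
        the_elem ((\<lambda>g. g F) ` A))"

text \<open>The \<open>S\<close>-linear map with \<open>F\<^sup>b \<mapsto> (m\<^sub>F / f\<^sub>b\<^sub>-\<^sub>b\<^sub>' (m\<^sub>F)) F\<^sup>b\<^sup>'\<close>; a functional \<open>u\<close> is the sum of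
  \<open>u (face_vector F)\<close> times \<open>F\<^sup>b\<close>.\<close>

definition transition ::
    "('p, 'n::finite) cell_complex \<Rightarrow> ('n \<Rightarrow> int) \<Rightarrow> ('n \<Rightarrow> int) \<Rightarrow> int \<Rightarrow>
     (('p set \<Rightarrow> ('n, 'k::field) mpoly) \<Rightarrow> ('n, 'k) mpoly) \<Rightarrow>
     (('p set \<Rightarrow> ('n, 'k) mpoly) \<Rightarrow> ('n, 'k) mpoly)" where
  "transition X b b' i u = (\<lambda>g \<in> carrier (chain (shifted_complex b' X) (- i)).
     \<Sum>F \<in> {F \<in> faces X. fdim X F = - i}.
       u (face_vector F) * monomial_of (label X F - shift_label (b - b') (label X F)) *
       shifted_dual_basis b' X F g)"

abbreviation const_vec :: "nat \<Rightarrow> 'n \<Rightarrow> int" where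
  "const_vec t \<equiv> \<lambda>_. int t"

definition limit_of_duals ::
    "('p, 'n::finite) cell_complex \<Rightarrow>
     ('n, 'k::field, nat \<Rightarrow> ('p set \<Rightarrow> ('n, 'k) mpoly) \<Rightarrow> ('n, 'k) mpoly) gcpx" where
  "limit_of_duals X = limit_complex (\<lambda>t. shifted_dual (const_vec t) X)
     (\<lambda>t t'. transition X (const_vec t) (const_vec t'))"

end

theory Submission
  imports Defs
begin

text \<open>Let \<open>Q\<close> be the set of faces outside \<open>X_U\<close>, that is, the faces whose label is at least \<open>1\<close> in every
coordinate. Both complexes are free on the dual basis elements of the faces in \<open>Q\<close>, with \<open>F\<close> in
multidegree \<open>- label X F\<close> and with the transposed incidence numbers as differential. On the
relative side this is immediate: \<open>X_U\<close> is a subcomplex because passing to a face can only decrease the label, so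
the quotient is free on \<open>Q\<close>, and one dualizes.

On the limit side, an element of degree \<open>c\<close> is a sequence of coefficient functions \<open>g t\<close> on all
faces, with \<open>g t F\<close> homogeneous of degree \<open>c + shift_label t (label F)\<close>, and \<open>g t'\<close> is obtained from
\<open>g t\<close> by multiplying with monomials. If \<open>F\<close> lies in \<open>Q\<close>, then \<open>shift_label\<close> fixes its label, the
monomial is \<open>1\<close>, and the coefficient at \<open>F\<close> is constant in \<open>t\<close>. If \<open>F\<close> lies in \<open>X_U\<close>, then some
coordinate of its label is \<open>0\<close>, and there the degree of \<open>g t F\<close> is \<open>c i - t\<close>; hence \<open>g t F = 0\<close> for
large \<open>t\<close>, and then for all \<open>t\<close> by compatibility. So the limit sees exactly the faces in \<open>Q\<close>
(lemma \<open>limit_comp_duals\<close>).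

The proof is organized around the explicit model \<open>face_complex (opposite X) Q (- label)\<close>: the dual of a
face complex is a face complex of the opposite incidence data (\<open>face_pairing_complex_iso\<close>), so
only face complexes have to be shown to be graded complexes by hand (\<open>face_complex_graded\<close>).
Everything else is compared with the model by isomorphisms along which the axioms of graded
complexes are transported (\<open>complex_iso_graded\<close>). The two comparisons are \<open>relative_dual_iso\<close> and
\<open>limit_of_duals_iso\<close>; the required isomorphism is the second after the inverse of the first.
The only topological input is that every nonempty face has a vertex
(\<open>regular_cell_complex_vertex\<close>): labels are maxima over vertices, and they are monotone only
because these maxima range over nonempty sets.\<close>

section \<open>Isomorphisms of graded modules and complexes\<close>

lemma cring_polyring: "cring (polyring :: ('n, 'k::field) mpoly ring)"
proof (rule cringI)
  show "abelian_group (polyring :: ('n, 'k) mpoly ring)"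
  proof (rule abelian_groupI)
    fix x assume "x \<in> carrier (polyring :: ('n, 'k) mpoly ring)"
    show "\<exists>y\<in>carrier polyring. y \<oplus>\<^bsub>polyring\<^esub> x = \<zero>\<^bsub>polyring :: ('n, 'k) mpoly ring\<^esub>"
      by (rule bexI[of _ "- x"]) (simp_all add: polyring_def)
  qed (simp_all add: polyring_def ac_simps)
  show "comm_monoid (polyring :: ('n, 'k) mpoly ring)"
    by (rule comm_monoidI) (simp_all add: polyring_def ac_simps)
qed (simp add: polyring_def algebra_simps)

text \<open>The condition on homogeneous components is an equality of images, and gradedness is demanded of
the source only. In this form the axioms of a graded module can be derived for the target, which
need not be known to be an abelian group beforehand.\<close>

definition graded_iso :: "('n, 'k::field, 'm) gmod \<Rightarrow> ('n, 'k, 'l) gmod \<Rightarrow> ('m \<Rightarrow> 'l) \<Rightarrow> bool" where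
  "graded_iso M N f \<longleftrightarrow>
     is_graded_module M \<and> bij_betw f (carrier M) (carrier N) \<and> f \<zero>\<^bsub>M\<^esub> = \<zero>\<^bsub>N\<^esub> \<and>
     (\<forall>x \<in> carrier M. \<forall>y \<in> carrier M. f (x \<oplus>\<^bsub>M\<^esub> y) = f x \<oplus>\<^bsub>N\<^esub> f y) \<and>
     (\<forall>s. \<forall>x \<in> carrier M. f (s \<odot>\<^bsub>M\<^esub> x) = s \<odot>\<^bsub>N\<^esub> f x) \<and>
     (\<forall>c. f ` hcomp M c = hcomp N c)"

lemma graded_moduleD:
  assumes "is_graded_module M"
  shows "Module.module polyring M" "abelian_group M" "hcomp M c \<subseteq> carrier M"
proof -
  show 1: "Module.module polyring M"
    using assms by (simp add: is_graded_module_def)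
  then show "abelian_group M"
    by (rule module.axioms)
  show "hcomp M c \<subseteq> carrier M"
    using assms by (auto simp: is_graded_module_def dest!: additive_subgroup.a_subset)
qed

lemma hom_finsum:
  assumes "abelian_group M" "abelian_group N"
    and f: "f \<in> carrier M \<rightarrow> carrier N" "f \<zero>\<^bsub>M\<^esub> = \<zero>\<^bsub>N\<^esub>"
      "\<forall>x \<in> carrier M. \<forall>y \<in> carrier M. f (x \<oplus>\<^bsub>M\<^esub> y) = f x \<oplus>\<^bsub>N\<^esub> f y"
    and "finite A" "g \<in> A \<rightarrow> carrier M"
  shows "f (finsum M g A) = finsum N (\<lambda>c. f (g c)) A"
proof -
  interpret M: abelian_group M by fact
  interpret N: abelian_group N by fact
  from assms(6,7) show ?thesis
  proof (induction A)
    case empty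
    then show ?case using f by simp
  next
    case (insert a A)
    then have "g a \<in> carrier M" "finsum M g A \<in> carrier M" "f (g a) \<in> carrier N"
      "(\<lambda>c. f (g c)) \<in> A \<rightarrow> carrier N"
      using f(1) by auto
    then show ?case using insert f by simp
  qed
qed

lemma graded_iso_abelian_group:
  assumes "graded_iso M N f"
  shows "abelian_group N"
proof -
  interpret M: abelian_group M
    using assms graded_moduleD(2) by (auto simp: graded_iso_def)
  have f: "carrier N = f ` carrier M" "f \<zero>\<^bsub>M\<^esub> = \<zero>\<^bsub>N\<^esub>"
    "\<And>x y. x \<in> carrier M \<Longrightarrow> y \<in> carrier M \<Longrightarrow> f x \<oplus>\<^bsub>N\<^esub> f y = f (x \<oplus>\<^bsub>M\<^esub> y)"
    using assms by (simp_all add: graded_iso_def bij_betw_def)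
  show ?thesis
  proof (rule abelian_groupI)
    fix x assume "x \<in> carrier N"
    then obtain x' where x': "x = f x'" "x' \<in> carrier M" using f by auto
    show "\<exists>y\<in>carrier N. y \<oplus>\<^bsub>N\<^esub> x = \<zero>\<^bsub>N\<^esub>"
      by (rule bexI[of _ "f (\<ominus>\<^bsub>M\<^esub> x')"]) (use x' f in \<open>simp_all add: M.l_neg\<close>)
    show "\<zero>\<^bsub>N\<^esub> \<oplus>\<^bsub>N\<^esub> x = x"
      using x' f(2) f(3)[of "\<zero>\<^bsub>M\<^esub>" x'] by simp
  next
    show "\<zero>\<^bsub>N\<^esub> \<in> carrier N" using f by (metis M.zero_closed imageI)
  qed (use f in \<open>auto simp: M.a_ac\<close>)
qed

lemma graded_iso_finsum:
  assumes f: "graded_iso M N f" and "finite A" "g \<in> A \<rightarrow> carrier M"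
  shows "f (finsum M g A) = finsum N (\<lambda>c. f (g c)) A"
proof (rule hom_finsum[OF _ _ _ _ _ assms(2,3)])
  show "abelian_group M" using f graded_moduleD(2)[of M] by (simp add: graded_iso_def)
  show "abelian_group N" by (rule graded_iso_abelian_group[OF f])
  show "f \<in> carrier M \<rightarrow> carrier N" using f by (auto simp: graded_iso_def bij_betw_def)
  show "f \<zero>\<^bsub>M\<^esub> = \<zero>\<^bsub>N\<^esub>" using f by (simp add: graded_iso_def)
  show "\<forall>x\<in>carrier M. \<forall>y\<in>carrier M. f (x \<oplus>\<^bsub>M\<^esub> y) = f x \<oplus>\<^bsub>N\<^esub> f y"
    using f by (simp add: graded_iso_def)
qed

lemma graded_iso_module:
  assumes "graded_iso M N f"
  shows "Module.module polyring N"
proof -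
  interpret M: Module.module polyring M
    using assms graded_moduleD(1) by (auto simp: graded_iso_def)
  have f: "carrier N = f ` carrier M"
    "\<And>x y. x \<in> carrier M \<Longrightarrow> y \<in> carrier M \<Longrightarrow> f x \<oplus>\<^bsub>N\<^esub> f y = f (x \<oplus>\<^bsub>M\<^esub> y)"
    "\<And>s x. x \<in> carrier M \<Longrightarrow> s \<odot>\<^bsub>N\<^esub> f x = f (s \<odot>\<^bsub>M\<^esub> x)"
    using assms by (simp_all add: graded_iso_def bij_betw_def)
  have c: "s \<in> carrier polyring" for s by (simp add: polyring_def)
  show ?thesis
  proof (rule moduleI[OF cring_polyring graded_iso_abelian_group[OF assms]])
  qed (use f in \<open>auto simp: c M.smult_l_distr M.smult_r_distr M.smult_assoc1\<close>)
qed

text \<open>Homogeneous families in the target are the images of homogeneous families in the source, so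
existence and uniqueness of homogeneous decompositions carry over.\<close>

lemma graded_iso_graded:
  assumes "graded_iso M N f"
  shows "is_graded_module N"
proof -
  have M: "is_graded_module M" and bij: "bij_betw f (carrier M) (carrier N)"
    and zero: "f \<zero>\<^bsub>M\<^esub> = \<zero>\<^bsub>N\<^esub>"
    and addall: "\<forall>x \<in> carrier M. \<forall>y \<in> carrier M. f (x \<oplus>\<^bsub>M\<^esub> y) = f x \<oplus>\<^bsub>N\<^esub> f y"
    and add: "\<And>x y. x \<in> carrier M \<Longrightarrow> y \<in> carrier M \<Longrightarrow> f x \<oplus>\<^bsub>N\<^esub> f y = f (x \<oplus>\<^bsub>M\<^esub> y)"
    and smult: "\<And>s x. x \<in> carrier M \<Longrightarrow> s \<odot>\<^bsub>N\<^esub> f x = f (s \<odot>\<^bsub>M\<^esub> x)"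
    and hc: "\<And>c. hcomp N c = f ` hcomp M c"
    using assms by (simp_all add: graded_iso_def)
  have f: "f \<in> carrier M \<rightarrow> carrier N" "inj_on f (carrier M)" "carrier N = f ` carrier M"
    using bij by (auto simp: bij_betw_def)
  interpret M: abelian_group M by (rule graded_moduleD(2)[OF M])
  interpret N: abelian_group N by (rule graded_iso_abelian_group[OF assms])
  have sub: "hcomp M c \<subseteq> carrier M" for c
    by (rule graded_moduleD(3)[OF M])
  have subN: "hcomp N c \<subseteq> carrier N" for c
    using sub f hc by blast
  have fzero: "f x = \<zero>\<^bsub>N\<^esub> \<longleftrightarrow> x = \<zero>\<^bsub>M\<^esub>" if "x \<in> carrier M" for x
    using that f(2) zero by (metis M.zero_closed inj_onD)
  have "additive_subgroup (hcomp N c) N" for c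
  proof -
    have h: "additive_subgroup (hcomp M c) M"
      using M by (simp add: is_graded_module_def)
    interpret h: additive_subgroup "hcomp M c" M by (rule h)
    show ?thesis
      unfolding additive_subgroup_def
    proof (rule group.subgroupI[OF N.a_group])
      show "hcomp N c \<subseteq> carrier (add_monoid N)" using subN by simp
      show "hcomp N c \<noteq> {}" unfolding hc using h.zero_closed by blast
    next
      fix a assume "a \<in> hcomp N c"
      then obtain a' where a': "a = f a'" "a' \<in> hcomp M c" using hc by auto
      have "a' \<in> carrier M" using a'(2) sub by auto
      then have "f (\<ominus>\<^bsub>M\<^esub> a') \<oplus>\<^bsub>N\<^esub> f a' = \<zero>\<^bsub>N\<^esub>"
        using add zero by (simp add: M.l_neg)
      then have "\<ominus>\<^bsub>N\<^esub> f a' = f (\<ominus>\<^bsub>M\<^esub> a')"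
        using \<open>a' \<in> carrier M\<close> f(1) by (intro N.minus_equality) auto
      then show "inv\<^bsub>add_monoid N\<^esub> a \<in> hcomp N c"
        using a' h.a_inv_closed hc by (simp add: a_inv_def)
    next
      fix a b assume "a \<in> hcomp N c" "b \<in> hcomp N c"
      then show "a \<otimes>\<^bsub>add_monoid N\<^esub> b \<in> hcomp N c"
        using hc add sub h.a_closed by (auto simp: subset_iff)
    qed
  qed
  moreover have "p \<odot>\<^bsub>N\<^esub> x \<in> hcomp N (c + d)" if px: "p \<in> poly_comp d" "x \<in> hcomp N c" for c d p x
  proof -
    obtain x' where "x = f x'" "x' \<in> hcomp M c" using px hc by auto
    moreover have "p \<odot>\<^bsub>M\<^esub> x' \<in> hcomp M (c + d)"
      using M px calculation by (simp add: is_graded_module_def)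
    ultimately show ?thesis using smult[of x' p] sub hc by (auto simp: subset_iff)
  qed
  moreover have "\<exists>!g. (\<forall>c. g c \<in> hcomp N c) \<and> finite {c. g c \<noteq> \<zero>\<^bsub>N\<^esub>} \<and>
        y = finsum N g {c. g c \<noteq> \<zero>\<^bsub>N\<^esub>}" if y: "y \<in> carrier N" for y
  proof -
    let ?D = "\<lambda>x g. (\<forall>c. g c \<in> hcomp M c) \<and> finite {c. g c \<noteq> \<zero>\<^bsub>M\<^esub>} \<and>
        x = finsum M g {c. g c \<noteq> \<zero>\<^bsub>M\<^esub>}"
    let ?E = "\<lambda>y g. (\<forall>c. g c \<in> hcomp N c) \<and> finite {c. g c \<noteq> \<zero>\<^bsub>N\<^esub>} \<and>
        y = finsum N g {c. g c \<noteq> \<zero>\<^bsub>N\<^esub>}"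
    obtain x where x: "x \<in> carrier M" "y = f x" using f y by auto
    have trans: "?D x' g \<longleftrightarrow> ?E (f x') (\<lambda>c. f (g c))"
      if g: "\<And>c. g c \<in> hcomp M c" and x': "x' \<in> carrier M" for g x'
    proof -
      have gc: "g c \<in> carrier M" for c using g sub by auto
      have S: "{c. f (g c) \<noteq> \<zero>\<^bsub>N\<^esub>} = {c. g c \<noteq> \<zero>\<^bsub>M\<^esub>}" using gc fzero by auto
      have "f (finsum M g {c. g c \<noteq> \<zero>\<^bsub>M\<^esub>}) = finsum N (\<lambda>c. f (g c)) {c. g c \<noteq> \<zero>\<^bsub>M\<^esub>}"
        if "finite {c. g c \<noteq> \<zero>\<^bsub>M\<^esub>}"
        by (rule hom_finsum[OF M.abelian_group_axioms N.abelian_group_axioms f(1) zero addall that])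
          (use gc in auto)
      moreover have "finsum M g {c. g c \<noteq> \<zero>\<^bsub>M\<^esub>} \<in> carrier M"
        using gc by (intro M.finsum_closed) auto
      ultimately show ?thesis
        unfolding S using g hc x' inj_on_eq_iff[OF f(2) x']
        by (metis imageI)
    qed
    have ex1: "\<exists>!g. ?D x g" using M x by (simp add: is_graded_module_def)
    then obtain g where g: "?D x g" by blast
    show ?thesis
    proof (rule ex1I[of _ "\<lambda>c. f (g c)"])
      show "?E y (\<lambda>c. f (g c))" using trans[of g x] g x by blast
    next
      fix g' assume g': "?E y g'"
      have "\<exists>u \<in> hcomp M c. g' c = f u" for c using g' hc by auto
      then obtain u where u: "\<And>c. u c \<in> hcomp M c" "\<And>c. g' c = f (u c)" by metis
      then have "g' = (\<lambda>c. f (u c))" by auto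
      then have "?E (f x) (\<lambda>c. f (u c))" using g' x(2) by simp
      then have "?D x u" using trans[OF u(1) x(1)] by (rule iffD2[rotated])
      then have "u = g" using ex1 g by blast
      then show "g' = (\<lambda>c. f (g c))" using u by auto
    qed
  qed
  ultimately show ?thesis
    unfolding is_graded_module_def using graded_iso_module[OF assms] by blast
qed

lemma graded_iso_sym:
  assumes "graded_iso M N f"
  shows "graded_iso N M (inv_into (carrier M) f)"
proof -
  let ?g = "inv_into (carrier M) f"
  have M: "is_graded_module M" and bij: "bij_betw f (carrier M) (carrier N)"
    and zero: "f \<zero>\<^bsub>M\<^esub> = \<zero>\<^bsub>N\<^esub>"
    and add: "\<And>x y. x \<in> carrier M \<Longrightarrow> y \<in> carrier M \<Longrightarrow> f x \<oplus>\<^bsub>N\<^esub> f y = f (x \<oplus>\<^bsub>M\<^esub> y)"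
    and smult: "\<And>s x. x \<in> carrier M \<Longrightarrow> s \<odot>\<^bsub>N\<^esub> f x = f (s \<odot>\<^bsub>M\<^esub> x)"
    and hc: "\<And>c. hcomp N c = f ` hcomp M c"
    using assms by (simp_all add: graded_iso_def)
  have N: "carrier N = f ` carrier M" and gf: "\<And>x. x \<in> carrier M \<Longrightarrow> ?g (f x) = x"
    using bij by (auto simp: bij_betw_def)
  interpret M: Module.module polyring M by (rule graded_moduleD(1)[OF M])
  have c: "s \<in> carrier polyring" for s by (simp add: polyring_def)
  have sub: "hcomp M c \<subseteq> carrier M" for c
    by (rule graded_moduleD(3)[OF M])
  have "?g ` hcomp N c = hcomp M c" for c
    unfolding hc image_image using gf sub by (force simp: image_iff subset_iff)
  then show ?thesis
    unfolding graded_iso_def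
    using graded_iso_graded[OF assms] bij_betw_inv_into[OF bij] zero gf N
    by (auto simp: add smult c gf simp flip: zero)
qed

lemma graded_iso_trans:
  assumes "graded_iso M N f" "graded_iso N L g"
  shows "graded_iso M L (\<lambda>x. g (f x))"
proof -
  have "f x \<in> carrier N" if "x \<in> carrier M" for x
    using assms(1) that by (auto simp: graded_iso_def bij_betw_def)
  moreover have "bij_betw (\<lambda>x. g (f x)) (carrier M) (carrier L)"
    using bij_betw_trans[of f "carrier M" "carrier N" g "carrier L"] assms
    by (simp add: graded_iso_def comp_def)
  moreover have "(\<lambda>x. g (f x)) ` hcomp M c = hcomp L c" for c
    using assms by (simp add: graded_iso_def flip: image_image)
  ultimately show ?thesis using assms by (simp add: graded_iso_def)
qed

lemma graded_iso_degree_zero_map: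
  assumes "graded_iso M N f"
  shows "degree_zero_map M N f"
  using assms by (auto simp: graded_iso_def degree_zero_map_def linear_map_def bij_betw_def)

text \<open>As for modules, being a graded complex is required of the source only; the target inherits it.\<close>

definition complex_iso :: "('n, 'k::field, 'm) gcpx \<Rightarrow> ('n, 'k, 'l) gcpx \<Rightarrow> (int \<Rightarrow> 'm \<Rightarrow> 'l) \<Rightarrow> bool" where
  "complex_iso C D \<phi> \<longleftrightarrow> is_graded_complex C \<and>
     (\<forall>i. graded_iso (chain C i) (chain D i) (\<phi> i) \<and>
          (\<forall>x \<in> carrier (chain C i). \<phi> (i - 1) (bdry C i x) = bdry D i (\<phi> i x)))"

lemma complex_iso_graded:
  assumes "complex_iso C D \<phi>"
  shows "is_graded_complex D"
proof -
  have C: "is_graded_complex C" and iso: "\<And>i. graded_iso (chain C i) (chain D i) (\<phi> i)"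
    and comm: "\<And>i x. x \<in> carrier (chain C i) \<Longrightarrow> bdry D i (\<phi> i x) = \<phi> (i - 1) (bdry C i x)"
    using assms by (simp_all add: complex_iso_def)
  have grC: "is_graded_module (chain C i)" for i using C by (simp add: is_graded_complex_def)
  have dz: "degree_zero_map (chain C i) (chain C (i - 1)) (bdry C i)" for i
    using C by (simp add: is_graded_complex_def)
  have sq: "bdry C (i - 1) (bdry C i x) = \<zero>\<^bsub>chain C (i - 2)\<^esub>" if "x \<in> carrier (chain C i)" for i x
    using C that by (simp add: is_graded_complex_def)
  have bc: "bdry C i x \<in> carrier (chain C (i - 1))" if "x \<in> carrier (chain C i)" for i x
    using dz[of i] that by (auto simp: degree_zero_map_def linear_map_def)
  have sub: "hcomp (chain C i) c \<subseteq> carrier (chain C i)" for i c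
    by (rule graded_moduleD(3)[OF grC])
  have car: "carrier (chain D i) = \<phi> i ` carrier (chain C i)" for i
    using iso[of i] by (simp add: graded_iso_def bij_betw_def)
  have hc: "hcomp (chain D i) c = \<phi> i ` hcomp (chain C i) c" for i c
    using iso[of i] by (simp add: graded_iso_def)
  have zero: "\<phi> i \<zero>\<^bsub>chain C i\<^esub> = \<zero>\<^bsub>chain D i\<^esub>" for i
    using iso[of i] by (simp add: graded_iso_def)
  have add: "\<phi> i x \<oplus>\<^bsub>chain D i\<^esub> \<phi> i y = \<phi> i (x \<oplus>\<^bsub>chain C i\<^esub> y)"
    if "x \<in> carrier (chain C i)" "y \<in> carrier (chain C i)" for i x y
    using iso[of i] that by (simp add: graded_iso_def)
  have smult: "s \<odot>\<^bsub>chain D i\<^esub> \<phi> i x = \<phi> i (s \<odot>\<^bsub>chain C i\<^esub> x)"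
    if "x \<in> carrier (chain C i)" for i x s
    using iso[of i] that by (simp add: graded_iso_def)
  have "is_graded_module (chain D i)" for i
    using graded_iso_graded[OF iso] .
  moreover have "bdry D (i - 1) (bdry D i y) = \<zero>\<^bsub>chain D (i - 2)\<^esub>"
    if y: "y \<in> carrier (chain D i)" for i y
  proof -
    obtain x where x: "x \<in> carrier (chain C i)" "y = \<phi> i x" using y car by auto
    have "bdry D (i - 1) (bdry D i y) = \<phi> (i - 1 - 1) (bdry C (i - 1) (bdry C i x))"
      using x comm bc by metis
    then show ?thesis using sq[OF x(1)] zero[of "i - 2"] by (simp add: algebra_simps)
  qed
  moreover have "degree_zero_map (chain D i) (chain D (i - 1)) (bdry D i)" for i
  proof -
    have lin: "bdry C i (x \<oplus>\<^bsub>chain C i\<^esub> y) = bdry C i x \<oplus>\<^bsub>chain C (i - 1)\<^esub> bdry C i y"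
         "bdry C i (s \<odot>\<^bsub>chain C i\<^esub> x) = s \<odot>\<^bsub>chain C (i - 1)\<^esub> bdry C i x"
      if "x \<in> carrier (chain C i)" "y \<in> carrier (chain C i)" for x y s
      using dz[of i] that by (auto simp: degree_zero_map_def linear_map_def)
    interpret M: Module.module polyring "chain C i" by (rule graded_moduleD(1)[OF grC])
    have c: "s \<in> carrier polyring" for s by (simp add: polyring_def)
    show ?thesis
      unfolding degree_zero_map_def linear_map_def
    proof (intro conjI ballI allI)
      show "bdry D i \<in> carrier (chain D i) \<rightarrow> carrier (chain D (i - 1))"
        by (auto simp: car comm bc)
      show "bdry D i ` hcomp (chain D i) c \<subseteq> hcomp (chain D (i - 1)) c" for c
      proof
        fix y assume "y \<in> bdry D i ` hcomp (chain D i) c"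
        then obtain x where "x \<in> hcomp (chain C i) c" "y = bdry D i (\<phi> i x)"
          using hc by auto
        moreover have "bdry C i x \<in> hcomp (chain C (i - 1)) c"
          using dz[of i] calculation(1) by (auto simp: degree_zero_map_def)
        ultimately show "y \<in> hcomp (chain D (i - 1)) c"
          using hc comm sub by (auto simp: subset_iff)
      qed
    qed (use lin in \<open>auto simp: car comm bc add smult c\<close>)
  qed
  ultimately show ?thesis by (simp add: is_graded_complex_def)
qed

lemma complex_iso_sym:
  assumes "complex_iso C D \<phi>"
  shows "complex_iso D C (\<lambda>i. inv_into (carrier (chain C i)) (\<phi> i))"
proof -
  have C: "is_graded_complex C" and iso: "\<And>i. graded_iso (chain C i) (chain D i) (\<phi> i)"
    and comm: "\<And>i x. x \<in> carrier (chain C i) \<Longrightarrow> bdry D i (\<phi> i x) = \<phi> (i - 1) (bdry C i x)"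
    using assms by (simp_all add: complex_iso_def)
  have bc: "bdry C i x \<in> carrier (chain C (i - 1))" if "x \<in> carrier (chain C i)" for i x
    using C that by (auto simp: is_graded_complex_def degree_zero_map_def linear_map_def)
  have inj: "inj_on (\<phi> i) (carrier (chain C i))" and car: "carrier (chain D i) = \<phi> i ` carrier (chain C i)" for i
    using iso[of i] by (auto simp: graded_iso_def bij_betw_def)
  show ?thesis
    unfolding complex_iso_def car using complex_iso_graded[OF assms] graded_iso_sym[OF iso]
    by (auto simp: comm bc inv_into_f_f[OF inj])
qed

lemma complex_iso_trans:
  assumes "complex_iso C D \<phi>" "complex_iso D E \<psi>"
  shows "complex_iso C E (\<lambda>i x. \<psi> i (\<phi> i x))"
proof -
  have "\<phi> i x \<in> carrier (chain D i)" if "x \<in> carrier (chain C i)" for i x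
    using assms(1) that unfolding complex_iso_def graded_iso_def by (meson bij_betw_apply)
  moreover have "graded_iso (chain C i) (chain E i) (\<lambda>x. \<psi> i (\<phi> i x))" for i
    using assms graded_iso_trans[of "chain C i" "chain D i" "\<phi> i" "chain E i" "\<psi> i"]
    by (simp add: complex_iso_def)
  ultimately show ?thesis
    using assms by (simp add: complex_iso_def)
qed

lemma complex_iso_imp_graded_complex_iso:
  assumes "complex_iso C D \<phi>"
  shows "graded_complex_iso C D \<phi>"
  unfolding graded_complex_iso_def
proof (intro conjI allI)
  fix i
  have "graded_iso (chain C i) (chain D i) (\<phi> i)"
    using assms by (simp add: complex_iso_def)
  then show "degree_zero_map (chain C i) (chain D i) (\<phi> i)"
    and "bij_betw (\<phi> i) (carrier (chain C i)) (carrier (chain D i))"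
    by (rule graded_iso_degree_zero_map, simp add: graded_iso_def)
qed (use assms complex_iso_graded[OF assms] in \<open>auto simp: complex_iso_def\<close>)

section \<open>Homogeneous polynomials of a fixed multidegree\<close>

abbreviation multideg :: "('n \<Rightarrow>\<^sub>0 nat) \<Rightarrow> 'n \<Rightarrow> int" where
  "multideg m \<equiv> (\<lambda>i. int (Poly_Mapping.lookup m i))"

lemma poly_comp_iff: "p \<in> poly_comp c \<longleftrightarrow> (\<forall>m. Poly_Mapping.lookup p m \<noteq> 0 \<longrightarrow> multideg m = c)"
  by (auto simp: poly_comp_def in_keys_iff fun_eq_iff)

lemma poly_comp_0: "0 \<in> poly_comp c"
  by (simp add: poly_comp_iff)

lemma poly_comp_add: "p \<in> poly_comp c \<Longrightarrow> q \<in> poly_comp c \<Longrightarrow> p + q \<in> poly_comp c"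
  by (auto simp: poly_comp_iff lookup_add) (metis add_0)

lemma poly_comp_uminus: "p \<in> poly_comp c \<Longrightarrow> - p \<in> poly_comp c"
  by (auto simp: poly_comp_iff)

lemma poly_comp_sum: "(\<And>a. a \<in> A \<Longrightarrow> f a \<in> poly_comp c) \<Longrightarrow> sum f A \<in> poly_comp c"
  by (induction A rule: infinite_finite_induct) (auto simp: poly_comp_0 poly_comp_add)

lemma poly_comp_mult:
  assumes "p \<in> poly_comp c" "q \<in> poly_comp d"
  shows "p * q \<in> poly_comp (c + d)"
proof -
  have "multideg m = c + d" if m: "m \<in> Poly_Mapping.keys (p * q)" for m
  proof -
    obtain a b where "m = a + b" "a \<in> Poly_Mapping.keys p" "b \<in> Poly_Mapping.keys q"
      using keys_mult[of p q] m by auto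
    then show ?thesis
      using assms by (auto simp: poly_comp_def lookup_add fun_eq_iff)
  qed
  then show ?thesis by (auto simp: poly_comp_def fun_eq_iff)
qed

lemma poly_comp_1: "1 \<in> poly_comp 0"
  by (auto simp: poly_comp_iff lookup_one fun_eq_iff when_def)

lemma poly_comp_of_int_mult: "p \<in> poly_comp c \<Longrightarrow> of_int k * p \<in> poly_comp c"
proof -
  assume p: "p \<in> poly_comp c"
  have "of_nat n * p \<in> poly_comp c" for n
    by (induction n) (auto simp: poly_comp_0 poly_comp_add distrib_right p)
  then show ?thesis
    by (cases k) (auto simp: poly_comp_uminus simp del: of_nat_Suc)
qed

text \<open>The polynomial ring lives in nonnegative degrees. In the limit this is what forces coefficients at
faces of \<open>X_U\<close> to vanish, since their degree tends to minus infinity in some coordinate.\<close>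

lemma poly_comp_negative:
  assumes "p \<in> poly_comp c" "c i < 0"
  shows "p = 0"
proof (rule poly_mapping_eqI)
  fix m
  show "Poly_Mapping.lookup p m = Poly_Mapping.lookup 0 m"
    using assms by (auto simp: poly_comp_iff fun_eq_iff) (metis of_nat_less_0_iff)
qed

lemma lookup_monomial_exponent:
  fixes e :: "'n::finite \<Rightarrow> int"
  shows "Poly_Mapping.lookup (Abs_poly_mapping (\<lambda>i. nat (e i))) = (\<lambda>i. nat (e i))"
  by (rule lookup_Abs_poly_mapping) simp

lemma monomial_of_in_poly_comp:
  assumes "0 \<le> e"
  shows "monomial_of e \<in> poly_comp e"
  using assms
  by (auto simp: monomial_of_def poly_comp_def lookup_monomial_exponent le_fun_def)

lemma monomial_of_0: "monomial_of 0 = 1"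
proof -
  have "Abs_poly_mapping (\<lambda>i::'a. nat (0 i)) = 0"
    by (rule poly_mapping_eqI) (simp add: lookup_monomial_exponent[of 0, simplified] zero_fun_def)
  then show ?thesis by (simp add: monomial_of_def)
qed

lemma monomial_of_add:
  assumes "0 \<le> d" "0 \<le> e"
  shows "monomial_of (d + e) = monomial_of d * monomial_of e"
proof -
  have "Abs_poly_mapping (\<lambda>i. nat ((d + e) i)) =
      Abs_poly_mapping (\<lambda>i. nat (d i)) + Abs_poly_mapping (\<lambda>i. nat (e i))"
    by (rule poly_mapping_eqI)
      (use assms in \<open>simp add: lookup_monomial_exponent lookup_add le_fun_def nat_add_distrib
         del: plus_fun_apply\<close>, simp add: plus_fun_def le_fun_def nat_add_distrib)
  then show ?thesis by (simp add: monomial_of_def mult_single)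
qed

section \<open>Free modules on faces and their boundary maps\<close>

lemma sum_apply_fun: "(sum h A) x = (\<Sum>a\<in>A. h a x)"
  by (induction A rule: infinite_finite_induct) auto

text \<open>The carrier of a face module does not depend on the labels. Keeping it free of them allows one and
the same pairing to be used for all label shifts.\<close>

abbreviation face_coeffs :: "('p, 'n) cell_complex \<Rightarrow> 'p set set \<Rightarrow> int \<Rightarrow> ('p set \<Rightarrow> ('n, 'k::field) mpoly) set" where
  "face_coeffs X B i \<equiv> {g. \<forall>F. (F \<in> B \<longrightarrow> fdim X F \<noteq> i) \<longrightarrow> g F = 0}"

lemma face_module_simps [simp]:
  "carrier (face_module X B l i) = face_coeffs X B i"
  "zero (face_module X B l i) = 0"
  "add (face_module X B l i) = (+)"
  "module.smult (face_module X B l i) = (\<lambda>s g F. s * g F)"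
  by (auto simp: face_module_def)

lemma hcomp_face_module:
  "hcomp (face_module X B l i) c =
    {g \<in> carrier (face_module X B l i). \<forall>F. g F \<in> poly_comp (c - l F)}"
  by (auto simp: face_module_def)

lemma face_module_abelian_group: "abelian_group (face_module X B l i)"
proof (rule abelian_groupI)
  fix x assume "x \<in> carrier (face_module X B l i)"
  then show "\<exists>y\<in>carrier (face_module X B l i).
      y \<oplus>\<^bsub>face_module X B l i\<^esub> x = \<zero>\<^bsub>face_module X B l i\<^esub>"
    by (intro bexI[of _ "- x"]) auto
qed (auto simp: add.assoc add.commute)

lemma face_module_module:
  "Module.module polyring (face_module X B l i :: ('n::finite, 'k::field, _) gmod)"
  by (rule moduleI[OF cring_polyring face_module_abelian_group])
    (auto simp: polyring_def fun_eq_iff algebra_simps)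

lemma finsum_face_module:
  assumes "finite A" "h \<in> A \<rightarrow> carrier (face_module X B l i)"
  shows "finsum (face_module X B l i) h A = sum h A"
proof -
  interpret abelian_group "face_module X B l i" by (rule face_module_abelian_group)
  from assms show ?thesis
    by (induction A) auto
qed

text \<open>The monomial \<open>m\<close> at the face \<open>F\<close> can only come from the summand of degree \<open>multideg m + l F\<close>. Hence the
coefficients of a sum of homogeneous elements can be read off one by one, which gives the
uniqueness of homogeneous decompositions.\<close>

lemma sum_hcomp_face_module_lookup:
  assumes "finite A" "\<And>c. c \<in> A \<Longrightarrow> h c \<in> hcomp (face_module X B l i) c"
  shows "Poly_Mapping.lookup (sum h A F) m =
    (if multideg m + l F \<in> A then Poly_Mapping.lookup (h (multideg m + l F) F) m else 0)"
proof -
  have 0: "Poly_Mapping.lookup (h c F) m = 0" if "c \<in> A" "c \<noteq> multideg m + l F" for c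
  proof -
    have "h c F \<in> poly_comp (c - l F)" using assms(2)[OF that(1)] by (auto simp: hcomp_face_module)
    then show ?thesis
      using that(2) by (auto simp: poly_comp_iff fun_eq_iff)
  qed
  have "Poly_Mapping.lookup (sum h A F) m = (\<Sum>c\<in>A. Poly_Mapping.lookup (h c F) m)"
    by (simp add: sum_apply_fun lookup_sum)
  also have "\<dots> = (\<Sum>c\<in>A. if c = multideg m + l F then Poly_Mapping.lookup (h (multideg m + l F) F) m else 0)"
    by (rule sum.cong) (use 0 in auto)
  finally show ?thesis using assms(1) by simp
qed

text \<open>The homogeneous part of degree \<open>c\<close>: with \<open>F\<close> in degree \<open>l F\<close>, the term with monomial \<open>m\<close> at \<open>F\<close> has
degree \<open>multideg m + l F\<close>.\<close>

definition face_part :: "('f \<Rightarrow> 'n \<Rightarrow> int) \<Rightarrow> ('f \<Rightarrow> ('n, 'k::field) mpoly) \<Rightarrow> ('n \<Rightarrow> int) \<Rightarrow>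
    'f \<Rightarrow> ('n, 'k) mpoly" where
  "face_part l g c F = Abs_poly_mapping
     (\<lambda>m. if multideg m + l F = c then Poly_Mapping.lookup (g F) m else 0)"

lemma lookup_face_part:
  "Poly_Mapping.lookup (face_part l g c F) m =
    (if multideg m + l F = c then Poly_Mapping.lookup (g F) m else 0)"
  unfolding face_part_def
  by (subst lookup_Abs_poly_mapping)
    (auto intro: finite_subset[OF _ finite_lookup[of "g F"]])

lemma face_part_hcomp:
  assumes "g \<in> carrier (face_module X B l i)"
  shows "face_part l g c \<in> hcomp (face_module X B l i) c"
proof -
  have "face_part l g c F = 0" if "g F = 0" for F
    using that by (intro poly_mapping_eqI) (simp add: lookup_face_part)
  moreover have "face_part l g c F \<in> poly_comp (c - l F)" for F
    by (auto simp: poly_comp_iff lookup_face_part)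
  ultimately show ?thesis using assms by (simp add: hcomp_face_module)
qed

lemma face_module_decomposition:
  assumes "finite B" "g \<in> carrier (face_module X B l i)"
  shows "finite {c. face_part l g c \<noteq> 0}"
    and "sum (face_part l g) {c. face_part l g c \<noteq> 0} = g"
proof -
  let ?S = "{c. face_part l g c \<noteq> 0}"
  have "?S \<subseteq> (\<Union>F\<in>B. (\<lambda>m. multideg m + l F) ` Poly_Mapping.keys (g F))"
  proof
    fix c assume "c \<in> ?S"
    then obtain F where "face_part l g c F \<noteq> 0" by (auto simp: fun_eq_iff)
    then obtain m where "Poly_Mapping.lookup (face_part l g c F) m \<noteq> 0"
      by (metis lookup_zero poly_mapping_eqI)
    then have "multideg m + l F = c" "Poly_Mapping.lookup (g F) m \<noteq> 0"
      by (auto simp: lookup_face_part split: if_splits)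
    moreover from this have "g F \<noteq> 0" by auto
    then have "F \<in> B" using assms by auto
    ultimately show "c \<in> (\<Union>F\<in>B. (\<lambda>m. multideg m + l F) ` Poly_Mapping.keys (g F))"
      by (auto simp: in_keys_iff intro!: bexI[of _ F] image_eqI[of _ _ m])
  qed
  then show fin: "finite ?S"
    by (rule finite_subset) (use assms in auto)
  have "Poly_Mapping.lookup (sum (face_part l g) ?S F) m = Poly_Mapping.lookup (g F) m" for F m
    using sum_hcomp_face_module_lookup[OF fin face_part_hcomp[OF assms(2)]]
    by (auto simp: lookup_face_part dest!: fun_cong[of _ _ F] arg_cong[of _ _ "\<lambda>p. Poly_Mapping.lookup p m"])
  then show "sum (face_part l g) ?S = g"
    by (intro ext poly_mapping_eqI)
qed

lemma face_module_graded:
  assumes "finite B"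
  shows "is_graded_module (face_module X B l i :: ('n::finite, 'k::field, _) gmod)"
proof -
  let ?M = "face_module X B l i :: ('n::finite, 'k::field, _) gmod"
  have sub: "hcomp ?M c \<subseteq> carrier ?M" for c by (auto simp: hcomp_face_module)
  have "additive_subgroup (hcomp ?M c) ?M" for c
    unfolding additive_subgroup_def
  proof (rule group.subgroupI[OF abelian_group.a_group[OF face_module_abelian_group]])
    show "hcomp ?M c \<subseteq> carrier (add_monoid ?M)" using sub by simp
    have "0 \<in> hcomp ?M c" by (simp add: hcomp_face_module poly_comp_0)
    then show "hcomp ?M c \<noteq> {}" by blast
  next
    fix a assume a: "a \<in> hcomp ?M c"
    have "\<ominus>\<^bsub>?M\<^esub> a = - a"
      using a sub by (intro abelian_group.minus_equality[OF face_module_abelian_group]) auto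
    moreover have "- a \<in> hcomp ?M c"
      using a by (auto simp: hcomp_face_module poly_comp_uminus)
    ultimately show "inv\<^bsub>add_monoid ?M\<^esub> a \<in> hcomp ?M c" by (simp add: a_inv_def)
  next
    fix a b assume "a \<in> hcomp ?M c" "b \<in> hcomp ?M c"
    then show "a \<otimes>\<^bsub>add_monoid ?M\<^esub> b \<in> hcomp ?M c"
      by (auto simp: hcomp_face_module poly_comp_add)
  qed
  moreover have "p \<odot>\<^bsub>?M\<^esub> x \<in> hcomp ?M (c + d)" if px: "p \<in> poly_comp d" "x \<in> hcomp ?M c" for c d p x
  proof -
    have "p * x F \<in> poly_comp (c + d - l F)" for F
      using poly_comp_mult[OF px(1), of "x F" "c - l F"] px(2)
      by (simp add: hcomp_face_module algebra_simps)
    then show ?thesis using px(2) by (auto simp: hcomp_face_module)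
  qed
  moreover have "\<exists>!g. (\<forall>c. g c \<in> hcomp ?M c) \<and> finite {c. g c \<noteq> \<zero>\<^bsub>?M\<^esub>} \<and>
        x = finsum ?M g {c. g c \<noteq> \<zero>\<^bsub>?M\<^esub>}" if x: "x \<in> carrier ?M" for x
  proof (rule ex1I[of _ "face_part l x"])
    have "face_part l x \<in> {c. face_part l x c \<noteq> 0} \<rightarrow> carrier ?M"
      using face_part_hcomp[OF x] sub by blast
    then show "(\<forall>c. face_part l x c \<in> hcomp ?M c) \<and> finite {c. face_part l x c \<noteq> \<zero>\<^bsub>?M\<^esub>} \<and>
        x = finsum ?M (face_part l x) {c. face_part l x c \<noteq> \<zero>\<^bsub>?M\<^esub>}"
      using face_part_hcomp[OF x] face_module_decomposition[OF assms x]
        finsum_face_module[of "{c. face_part l x c \<noteq> 0}" "face_part l x" X B l i]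
      by (simp del: face_module_simps(1))
  next
    fix g assume g: "(\<forall>c. g c \<in> hcomp ?M c) \<and> finite {c. g c \<noteq> \<zero>\<^bsub>?M\<^esub>} \<and>
        x = finsum ?M g {c. g c \<noteq> \<zero>\<^bsub>?M\<^esub>}"
    let ?S = "{c. g c \<noteq> 0}"
    have fin: "finite ?S" and gh: "\<And>c. g c \<in> hcomp ?M c" using g by auto
    have xs: "x = sum g ?S"
      using g gh sub finsum_face_module[of ?S g X B l i]
      by (auto simp: subset_iff simp del: face_module_simps(1))
    have "Poly_Mapping.lookup (g c F) m = Poly_Mapping.lookup (face_part l x c F) m" for c F m
    proof (cases "multideg m + l F = c")
      case True
      then show ?thesis
        using sum_hcomp_face_module_lookup[OF fin gh, of F m]
        by (auto simp: lookup_face_part xs)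
    next
      case False
      have "g c F \<in> poly_comp (c - l F)" using gh[of c] by (simp add: hcomp_face_module)
      then show ?thesis using False by (auto simp: lookup_face_part poly_comp_iff fun_eq_iff)
    qed
    then show "g = face_part l x"
      by (intro ext poly_mapping_eqI)
  qed
  ultimately show ?thesis
    unfolding is_graded_module_def using face_module_module by blast
qed

text \<open>Exactly what makes \<open>face_complex X B l\<close> a graded complex, whatever the origin of the incidence
numbers. The conditions are symmetric under transposition and survive the removal of a subcomplex,
and so pass to duals and to quotients.\<close>

definition graded_incidence :: "('p, 'n) cell_complex \<Rightarrow> 'p set set \<Rightarrow> ('p set \<Rightarrow> 'n \<Rightarrow> int) \<Rightarrow> bool" where
  "graded_incidence X B l \<longleftrightarrow> finite B \<and>
     (\<forall>F\<in>B. \<forall>G\<in>B. incidence X F G \<noteq> 0 \<longrightarrow> fdim X G = fdim X F - 1 \<and> l G \<le> l F) \<and>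
     (\<forall>F\<in>B. \<forall>H\<in>B. (\<Sum>G\<in>B. incidence X F G * incidence X G H) = 0)"

abbreviation bdry_coeff :: "('p, 'n::finite) cell_complex \<Rightarrow> ('p set \<Rightarrow> 'n \<Rightarrow> int) \<Rightarrow> 'p set \<Rightarrow> 'p set \<Rightarrow>
   ('n, 'k::field) mpoly" where
  "bdry_coeff X l F G \<equiv> of_int (incidence X F G) * monomial_of (l F - l G)"

lemma face_complex_simps [simp]:
  "chain (face_complex X B l) = face_module X B l"
  "bdry (face_complex X B l) = (\<lambda>i g G. if G \<in> B
          then \<Sum>F \<in> {F \<in> B. fdim X F = i}. g F * bdry_coeff X l F G else 0)"
  by (simp_all add: face_complex_def)

lemma bdry_coeff_poly_comp:
  assumes "graded_incidence X B l" "F \<in> B" "G \<in> B"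
  shows "bdry_coeff X l F G \<in> poly_comp (l F - l G)"
proof (cases "incidence X F G = 0")
  case True
  then show ?thesis by (simp add: poly_comp_0)
next
  case False
  then have "0 \<le> l F - l G" using assms by (auto simp: graded_incidence_def le_fun_def)
  then show ?thesis by (intro poly_comp_of_int_mult monomial_of_in_poly_comp)
qed

text \<open>Labels decrease when passing to faces, so the monomials along a two-step path from \<open>F\<close> to \<open>H\<close> multiply
to the monomial with exponent \<open>l F - l H\<close>, whatever the middle face is. The sum is therefore this
monomial times a sum of products of incidence numbers.\<close>

lemma sum_bdry_coeff_zero:
  assumes B: "graded_incidence X B l" and FH: "F \<in> B" "H \<in> B"
  shows "(\<Sum>G\<in>B. bdry_coeff X l F G * bdry_coeff X l G H) = (0 :: ('n::finite, 'k::field) mpoly)"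
proof -
  have "bdry_coeff X l F G * bdry_coeff X l G H =
      (of_int (incidence X F G * incidence X G H) * monomial_of (l F - l H) :: ('n, 'k) mpoly)" if G: "G \<in> B" for G
  proof (cases "incidence X F G = 0 \<or> incidence X G H = 0")
    case False
    then have le: "0 \<le> l F - l G" "0 \<le> l G - l H"
      using B FH G by (auto simp: graded_incidence_def le_fun_def)
    have "monomial_of (l F - l H) = monomial_of (l F - l G) * (monomial_of (l G - l H) :: ('n, 'k) mpoly)"
      using monomial_of_add[OF le] by (simp add: algebra_simps)
    then show ?thesis by (simp add: algebra_simps)
  qed auto
  then have "(\<Sum>G\<in>B. bdry_coeff X l F G * bdry_coeff X l G H) =
      (of_int (\<Sum>G\<in>B. incidence X F G * incidence X G H) * monomial_of (l F - l H) :: ('n, 'k) mpoly)"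
    by (simp add: sum_distrib_right)
  moreover have "(\<Sum>G\<in>B. incidence X F G * incidence X G H) = 0"
    using B FH by (simp add: graded_incidence_def)
  ultimately show ?thesis by (simp only: of_int_0 mult_zero_left)
qed

lemma face_complex_bdry_carrier:
  assumes "graded_incidence X B l"
  shows "bdry (face_complex X B l) i g \<in> carrier (face_module X B l (i - 1))"
proof -
  have "(\<Sum>F \<in> {F \<in> B. fdim X F = i}. g F * bdry_coeff X l F G) = 0" if "G \<in> B" "fdim X G \<noteq> i - 1" for G
  proof (rule sum.neutral, clarify)
    fix F assume "F \<in> B" "i = fdim X F"
    then have "incidence X F G = 0"
      using assms that by (auto simp: graded_incidence_def)
    then show "g F * bdry_coeff X l F G = 0" by simp
  qed
  then show ?thesis by auto
qed

lemma face_complex_graded: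
  fixes X :: "('p, 'n::finite) cell_complex"
  assumes B: "graded_incidence X B l"
  shows "is_graded_complex (face_complex X B l :: ('n::finite, 'k::field, _) gcpx)"
proof -
  let ?C = "face_complex X B l :: ('n::finite, 'k::field, _) gcpx"
  have fin: "finite B" using B by (simp add: graded_incidence_def)
  have "degree_zero_map (face_module X B l i) (face_module X B l (i - 1)) (bdry ?C i)" for i
    unfolding degree_zero_map_def linear_map_def
  proof (intro conjI allI ballI)
    show "bdry ?C i \<in> carrier (face_module X B l i) \<rightarrow> carrier (face_module X B l (i - 1))"
      using face_complex_bdry_carrier[OF B] by blast
    show "bdry ?C i ` hcomp (face_module X B l i) c \<subseteq> hcomp (face_module X B l (i - 1)) c" for c
    proof clarify
      fix g :: "'p set \<Rightarrow> ('n, 'k) mpoly" assume g: "g \<in> hcomp (face_module X B l i) c"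
      have "g F * bdry_coeff X l F G \<in> poly_comp (c - l G)" if "F \<in> B" "G \<in> B" for F G
        using poly_comp_mult[of "g F" "c - l F", OF _ bdry_coeff_poly_comp[OF B that]] g
        by (simp add: hcomp_face_module)
      then have "bdry ?C i g G \<in> poly_comp (c - l G)" for G
        by (auto intro!: poly_comp_sum poly_comp_0)
      then show "bdry ?C i g \<in> hcomp (face_module X B l (i - 1)) c"
        using face_complex_bdry_carrier[OF B, of i g] unfolding hcomp_face_module by blast
    qed
  qed (auto simp: fun_eq_iff sum_distrib_left distrib_right sum.distrib mult.assoc)
  moreover have "bdry ?C (i - 1) (bdry ?C i g) = 0" for i g
  proof
    fix H
    let ?R = "\<lambda>i. {F \<in> B. fdim X F = i}"
    have "bdry ?C (i - 1) (bdry ?C i g) H = 0" if H: "H \<in> B"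
    proof -
      have "bdry ?C (i - 1) (bdry ?C i g) H =
          (\<Sum>G \<in> ?R (i - 1). (\<Sum>F \<in> ?R i. g F * bdry_coeff X l F G) * bdry_coeff X l G H)"
        using H by simp
      also have "\<dots> = (\<Sum>G \<in> B. (\<Sum>F \<in> ?R i. g F * bdry_coeff X l F G) * bdry_coeff X l G H)"
      proof (rule sum.mono_neutral_left[OF fin])
        show "\<forall>G\<in>B - ?R (i - 1). (\<Sum>F \<in> ?R i. g F * bdry_coeff X l F G) * bdry_coeff X l G H = 0"
          using face_complex_bdry_carrier[OF B, of i g] by fastforce
      qed auto
      also have "\<dots> = (\<Sum>F \<in> ?R i. g F * (\<Sum>G \<in> B. bdry_coeff X l F G * bdry_coeff X l G H))"
        unfolding sum_distrib_left sum_distrib_right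
        by (subst sum.swap) (simp add: mult.assoc)
      also have "\<dots> = 0"
      proof (rule sum.neutral, clarify)
        fix F assume "F \<in> B"
        then show "g F * (\<Sum>G \<in> B. bdry_coeff X l F G * bdry_coeff X l G H) = 0"
          by (simp only: sum_bdry_coeff_zero[OF B _ H] mult_zero_right)
      qed
      finally show ?thesis .
    qed
    then show "bdry ?C (i - 1) (bdry ?C i g) H = 0 H" by (cases "H \<in> B") simp_all
  qed
  ultimately show ?thesis
    by (simp add: is_graded_complex_def face_module_graded[OF fin])
qed

section \<open>The dual of a face complex is a face complex\<close>

text \<open>Transposed incidence numbers and negated dimensions. This is no longer a cell complex, but its face
complexes, with negated labels, are the duals of those of \<open>X\<close>.\<close>

definition opposite :: "('p, 'n) cell_complex \<Rightarrow> ('p, 'n) cell_complex" where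
  "opposite X = X\<lparr>fdim := \<lambda>F. - fdim X F, incidence := \<lambda>F G. incidence X G F\<rparr>"

lemma opposite_simps [simp]:
  "fdim (opposite X) F = - fdim X F" "incidence (opposite X) F G = incidence X G F"
  by (simp_all add: opposite_def)

lemma neg_eq_swap: "- fdim X F = i \<longleftrightarrow> fdim X F = - i"
  by auto

lemma graded_incidence_opposite:
  assumes "graded_incidence X B l"
  shows "graded_incidence (opposite X) B (\<lambda>F. - l F)"
proof -
  have "(\<Sum>G\<in>B. incidence X G F * incidence X H G) = 0" if "F \<in> B" "H \<in> B" for F H
  proof -
    have "(\<Sum>G\<in>B. incidence X H G * incidence X G F) = 0"
      using assms that by (simp add: graded_incidence_def)
    then show ?thesis by (simp only: mult.commute)
  qed
  then show ?thesis using assms by (auto simp: graded_incidence_def le_fun_def)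
qed

lemma dual_module_simps [simp]:
  "carrier (dual_module M) = {f. \<exists>A h. finite A \<and> (\<forall>c \<in> A. h c \<in> homogeneous_functionals M c) \<and>
                        f = (\<lambda>x \<in> carrier M. \<Sum>c\<in>A. h c x)}"
  "zero (dual_module M) = (\<lambda>x \<in> carrier M. 0)"
  "add (dual_module M) = (\<lambda>f g. \<lambda>x \<in> carrier M. f x + g x)"
  "module.smult (dual_module M) = (\<lambda>s f. \<lambda>x \<in> carrier M. s * f x)"
  "hcomp (dual_module M) = homogeneous_functionals M"
  by (simp_all add: dual_module_def)

lemma dual_complex_simps [simp]:
  "chain (dual_complex C) i = dual_module (chain C (- i))"
  "bdry (dual_complex C) i f = (\<lambda>x \<in> carrier (chain C (1 - i)). f (bdry C (1 - i) x))"
  by (simp_all add: dual_complex_def)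

text \<open>The functional \<open>\<Sum>F. g F * F\<^sup>*\<close>, where \<open>F\<^sup>*\<close> is the coefficient at \<open>F\<close>. As no label occurs in
it, the same functional makes sense for all label shifts.\<close>

definition face_pairing :: "('p, 'n::finite) cell_complex \<Rightarrow> 'p set set \<Rightarrow> int \<Rightarrow>
    ('p set \<Rightarrow> ('n, 'k::field) mpoly) \<Rightarrow> ('p set \<Rightarrow> ('n, 'k) mpoly) \<Rightarrow> ('n, 'k) mpoly" where
  "face_pairing X B j g = (\<lambda>h \<in> face_coeffs X B j. \<Sum>F\<in>{F \<in> B. fdim X F = j}. g F * h F)"

lemma face_vector_in_face_coeffs:
  "F \<in> B \<Longrightarrow> fdim X F = j \<Longrightarrow> face_vector F \<in> face_coeffs X B j"
  by (auto simp: face_vector_def)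

lemma face_vector_in_hcomp:
  "F \<in> B \<Longrightarrow> fdim X F = j \<Longrightarrow> face_vector F \<in> hcomp (face_module X B l j) (l F)"
  by (auto simp: hcomp_face_module face_vector_def poly_comp_0 poly_comp_1)

lemma face_pairing_face_vector:
  assumes "finite B" "F \<in> B" "fdim X F = j"
  shows "face_pairing X B j g (face_vector F) = g F"
proof -
  have "(\<Sum>G\<in>{F \<in> B. fdim X F = j}. g G * face_vector F G) =
      (\<Sum>G\<in>{F \<in> B. fdim X F = j}. if G = F then g F else 0)"
    by (rule sum.cong) (auto simp: face_vector_def)
  also have "\<dots> = g F" using assms by simp
  finally show ?thesis
    by (simp only: face_pairing_def restrict_apply face_vector_in_face_coeffs[OF assms(2,3)] if_True)
qed

lemma face_pairing_face_vector_left: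
  assumes "finite B" "F \<in> B" "fdim X F = j"
  shows "face_pairing X B j (face_vector F) = (\<lambda>h \<in> face_coeffs X B j. h F)"
  unfolding face_pairing_def
proof (rule restrict_ext)
  fix h :: "'a set \<Rightarrow> ('b, 'c) mpoly"
  have "(\<Sum>G\<in>{F \<in> B. fdim X F = j}. face_vector F G * h G) =
      (\<Sum>G\<in>{F \<in> B. fdim X F = j}. if G = F then h F else 0)"
    by (rule sum.cong) (auto simp: face_vector_def)
  then show "(\<Sum>G\<in>{F \<in> B. fdim X F = j}. face_vector F G * h G) = h F"
    using assms by simp
qed

lemma face_pairing_inj:
  assumes "finite B" "g \<in> face_coeffs X B j" "g' \<in> face_coeffs X B j"
    and "face_pairing X B j g = face_pairing X B j g'"
  shows "g = g'"
proof
  fix F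
  show "g F = g' F"
  proof (cases "F \<in> B \<and> fdim X F = j")
    case True
    then show ?thesis using face_pairing_face_vector assms by metis
  qed (use assms in auto)
qed

lemma face_pairing_sum:
  "face_pairing X B j (sum g A) = (\<lambda>x\<in>face_coeffs X B j. \<Sum>c\<in>A. face_pairing X B j (g c) x)"
  unfolding face_pairing_def
  by (rule restrict_ext, simp add: sum_apply_fun sum_distrib_right) (rule sum.swap)

lemma functional_expansion:
  assumes "finite B" "h \<in> face_coeffs X B j"
    and add: "\<And>x y. x \<in> face_coeffs X B j \<Longrightarrow> y \<in> face_coeffs X B j \<Longrightarrow> u (\<lambda>F. x F + y F) = u x + u y"
    and smult: "\<And>s x. x \<in> face_coeffs X B j \<Longrightarrow> u (\<lambda>F. s * x F) = s * u x"
  shows "u h = (\<Sum>F\<in>{F \<in> B. fdim X F = j}. u (face_vector F) * h F)"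
proof -
  let ?R = "{F \<in> B. fdim X F = j}"
  have partial: "u (\<lambda>G. if G \<in> A then h G else 0) = (\<Sum>F\<in>A. u (face_vector F) * h F)" if "A \<subseteq> ?R" for A
  proof -
    have "finite A" using that assms(1) by (auto intro: finite_subset)
    then show ?thesis using that
    proof (induction A)
      case empty
      then show ?case using smult[OF assms(2), of 0] by simp
    next
      case (insert F A)
      then have F: "F \<in> B" "fdim X F = j" by auto
      note e = face_vector_in_face_coeffs[OF F]
      have "(\<lambda>G. if G \<in> insert F A then h G else 0) =
          (\<lambda>G. (if G \<in> A then h G else 0) + h F * face_vector F G)"
        using insert by (auto simp: face_vector_def fun_eq_iff)
      moreover have "u (\<lambda>G. (if G \<in> A then h G else 0) + h F * face_vector F G) =
          u (\<lambda>G. if G \<in> A then h G else 0) + u (\<lambda>G. h F * face_vector F G)"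
        by (rule add) (use insert assms(2) F in \<open>auto simp: face_vector_def\<close>)
      ultimately show ?case
        using smult[OF e, of "h F"] insert by (simp add: mult.commute)
    qed
  qed
  have "(\<lambda>G. if G \<in> ?R then h G else 0) = h"
    using assms(2) by auto
  then show ?thesis using partial[OF subset_refl] by simp
qed

text \<open>A functional is determined by its values on the basis, and it has degree \<open>c\<close> iff the value on each
face \<open>F\<close> has degree \<open>c + l F\<close>. This is the degree condition for coefficient functions with respect to
the negated labels.\<close>

lemma homogeneous_functionals_face_module:
  fixes X :: "('p, 'n::finite) cell_complex"
  assumes "finite B"
  shows "face_pairing X B (- i) ` hcomp (face_module (opposite X) B (\<lambda>F. - l F) i) c =
    (homogeneous_functionals (face_module X B l (- i)) c :: (_ \<Rightarrow> ('n, 'k::field) mpoly) set)"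
proof (intro equalityI subsetI)
  fix u :: "_ \<Rightarrow> ('n, 'k) mpoly"
  assume "u \<in> face_pairing X B (- i) ` hcomp (face_module (opposite X) B (\<lambda>F. - l F) i) c"
  then obtain g where g: "\<And>F. g F \<in> poly_comp (c + l F)" and u: "u = face_pairing X B (- i) g"
    by (auto simp: hcomp_face_module)
  have "u x \<in> poly_comp (c + d)" if "x \<in> hcomp (face_module X B l (- i)) d" for d x
  proof -
    have "g F * x F \<in> poly_comp (c + d)" for F
      using poly_comp_mult[OF g[of F], of "x F" "d - l F"] that by (simp add: hcomp_face_module)
    moreover have "x \<in> face_coeffs X B (- i)" using that by (simp add: hcomp_face_module)
    ultimately show ?thesis by (simp add: u face_pairing_def poly_comp_sum)
  qed
  then show "u \<in> homogeneous_functionals (face_module X B l (- i)) c"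
    by (auto simp: homogeneous_functionals_def u face_pairing_def
        sum.distrib distrib_left sum_distrib_left mult.left_commute)
next
  fix u :: "_ \<Rightarrow> ('n, 'k) mpoly"
  assume u: "u \<in> homogeneous_functionals (face_module X B l (- i)) c"
  define g where "g F = (if F \<in> B \<and> fdim X F = - i then u (face_vector F) else 0)" for F
  have "g F \<in> poly_comp (c + l F)" for F
  proof -
    have "u (face_vector F) \<in> poly_comp (c + l F)" if "F \<in> B" "fdim X F = - i"
    proof -
      have "\<forall>x\<in>hcomp (face_module X B l (- i)) (l F). u x \<in> poly_comp (c + l F)"
        using u unfolding homogeneous_functionals_def by blast
      then show ?thesis by (rule bspec) (rule face_vector_in_hcomp[OF that])
    qed
    then show ?thesis by (auto simp: g_def poly_comp_0)
  qed
  then have "g \<in> hcomp (face_module (opposite X) B (\<lambda>F. - l F) i) c"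
    by (auto simp: hcomp_face_module g_def)
  moreover have "u = face_pairing X B (- i) g"
  proof
    fix h
    show "u h = face_pairing X B (- i) g h"
    proof (cases "h \<in> face_coeffs X B (- i)")
      case True
      have "u h = (\<Sum>F\<in>{F \<in> B. fdim X F = - i}. u (face_vector F) * h F)"
        by (rule functional_expansion[OF assms True])
          (use u in \<open>simp_all add: homogeneous_functionals_def plus_fun_def\<close>)
      also have "\<dots> = (\<Sum>F\<in>{F \<in> B. fdim X F = - i}. g F * h F)"
        by (rule sum.cong) (auto simp: g_def)
      finally show ?thesis using True by (simp add: face_pairing_def)
    next
      case False
      then show ?thesis
        using u by (simp add: face_pairing_def homogeneous_functionals_def extensional_def
            del: mem_Collect_eq) simp
    qed
  qed
  ultimately show "u \<in> face_pairing X B (- i) ` hcomp (face_module (opposite X) B (\<lambda>F. - l F) i) c"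
    by blast
qed

lemma carrier_face_module_opposite: "carrier (face_module (opposite X) B l i) = face_coeffs X B (- i)"
  by (simp add: neg_eq_swap)

text \<open>The graded dual consists of finite sums of homogeneous functionals. Surjectivity onto it thus
follows from the homogeneous case by taking sums, and that every coefficient function gives such a
sum is its decomposition into homogeneous parts.\<close>

lemma face_pairing_iso:
  fixes X :: "('p, 'n::finite) cell_complex"
  assumes "finite B"
  shows "graded_iso (face_module (opposite X) B (\<lambda>F. - l F) i :: ('n, 'k::field, _) gmod)
    (dual_module (face_module X B l (- i))) (face_pairing X B (- i))"
proof -
  let ?M = "face_module (opposite X) B (\<lambda>F. - l F) i :: ('n, 'k, _) gmod"
  let ?D = "dual_module (face_module X B l (- i)) :: ('n, 'k, _) gmod"
  let ?f = "face_pairing X B (- i)"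
  have hf: "?f ` hcomp ?M c = homogeneous_functionals (face_module X B l (- i)) c" for c
    by (rule homogeneous_functionals_face_module[OF assms])
  have "inj_on ?f (carrier ?M)"
    unfolding carrier_face_module_opposite by (rule inj_onI) (rule face_pairing_inj[OF assms])
  moreover have "?f ` carrier ?M = carrier ?D"
  proof (intro equalityI subsetI)
    fix u assume "u \<in> ?f ` carrier ?M"
    then obtain g where g: "g \<in> carrier ?M" "u = ?f g" by blast
    let ?p = "face_part (\<lambda>F. - l F) g" and ?S = "{c. face_part (\<lambda>F. - l F) g c \<noteq> 0}"
    have "u = ?f (sum ?p ?S)"
      using face_module_decomposition(2)[OF assms g(1)] g by simp
    then have "u = (\<lambda>x\<in>carrier (face_module X B l (- i)). \<Sum>c\<in>?S. ?f (?p c) x)"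
      unfolding face_pairing_sum by simp
    moreover have "?f (?p c) \<in> homogeneous_functionals (face_module X B l (- i)) c" for c
      using face_part_hcomp[OF g(1), of c] hf by blast
    ultimately show "u \<in> carrier ?D"
      unfolding dual_module_simps(1) mem_Collect_eq
      using face_module_decomposition(1)[OF assms g(1)]
      by (intro exI[of _ ?S] exI[of _ "\<lambda>c. ?f (?p c)"] conjI) blast+
  next
    fix u assume "u \<in> carrier ?D"
    then obtain A h where h: "finite A" "\<forall>c\<in>A. h c \<in> homogeneous_functionals (face_module X B l (- i)) c"
      "u = (\<lambda>x \<in> carrier (face_module X B l (- i)). \<Sum>c\<in>A. h c x)"
      unfolding dual_module_simps(1) by blast
    then have "\<forall>c\<in>A. \<exists>g. g \<in> hcomp ?M c \<and> h c = ?f g" using hf by blast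
    then obtain g where g: "\<forall>c\<in>A. g c \<in> hcomp ?M c \<and> h c = ?f (g c)" by metis
    have "u = ?f (sum g A)"
      unfolding face_pairing_sum h(3) face_module_simps(1)
      by (rule restrict_ext) (use g in \<open>auto intro: sum.cong\<close>)
    moreover have "sum g A \<in> carrier ?M"
      using g by (auto simp: hcomp_face_module sum_apply_fun intro!: sum.neutral)
    ultimately show "u \<in> ?f ` carrier ?M" by blast
  qed
  moreover have "?f (x + y) = ?f x \<oplus>\<^bsub>?D\<^esub> ?f y" for x y
    by (auto simp: face_pairing_def fun_eq_iff distrib_right sum.distrib)
  moreover have "?f (\<lambda>F. s * x F) = s \<odot>\<^bsub>?D\<^esub> ?f x" for x s
    by (auto simp: face_pairing_def fun_eq_iff sum_distrib_left mult.assoc)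
  moreover have "?f 0 = \<zero>\<^bsub>?D\<^esub>"
    by (auto simp: face_pairing_def fun_eq_iff)
  ultimately show ?thesis
    unfolding graded_iso_def bij_betw_def using hf face_module_graded[OF assms]
    by (simp del: dual_module_simps(1,2,3,4) face_module_simps(1))
qed

text \<open>Precomposition with the boundary map transposes its matrix: this is an exchange of two sums.\<close>

lemma face_pairing_bdry:
  fixes X :: "('p, 'n::finite) cell_complex" and g :: "'p set \<Rightarrow> ('n, 'k::field) mpoly"
  assumes B: "graded_incidence X B l" and x: "x \<in> face_coeffs X B (1 - i)"
  shows "face_pairing X B (1 - i) (bdry (face_complex (opposite X) B (\<lambda>F. - l F)) i g) x =
    face_pairing X B (- i) g (bdry (face_complex X B l) (1 - i) x)"
proof -
  let ?R = "\<lambda>j. {F \<in> B. fdim X F = j}"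
  have "bdry (face_complex X B l) (1 - i) x \<in> face_coeffs X B (- i)"
    using face_complex_bdry_carrier[OF B, of "1 - i" x] by simp
  then have "face_pairing X B (- i) g (bdry (face_complex X B l) (1 - i) x) =
      (\<Sum>G\<in>?R (- i). g G * bdry (face_complex X B l) (1 - i) x G)"
    by (simp only: face_pairing_def restrict_apply if_True)
  also have "\<dots> = (\<Sum>G\<in>?R (- i). \<Sum>F\<in>?R (1 - i). g G * bdry_coeff X l F G * x F)"
    by (rule sum.cong) (auto simp: sum_distrib_left ac_simps)
  also have "\<dots> = (\<Sum>F\<in>?R (1 - i). \<Sum>G\<in>?R (- i). g G * bdry_coeff X l F G * x F)"
    by (rule sum.swap)
  also have "\<dots> = (\<Sum>F\<in>?R (1 - i). bdry (face_complex (opposite X) B (\<lambda>F. - l F)) i g F * x F)"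
    by (rule sum.cong) (auto simp: sum_distrib_right neg_eq_swap intro!: sum.cong)
  also have "\<dots> = face_pairing X B (1 - i) (bdry (face_complex (opposite X) B (\<lambda>F. - l F)) i g) x"
    using x by (simp only: face_pairing_def restrict_apply if_True)
  finally show ?thesis by simp
qed

lemma face_pairing_complex_iso:
  fixes X :: "('p, 'n::finite) cell_complex"
  assumes B: "graded_incidence X B l"
  shows "complex_iso (face_complex (opposite X) B (\<lambda>F. - l F) :: ('n, 'k::field, _) gcpx)
    (dual_complex (face_complex X B l)) (\<lambda>i. face_pairing X B (- i))"
proof -
  have fin: "finite B" using B by (simp add: graded_incidence_def)
  have "face_pairing X B (- (i - 1)) (bdry (face_complex (opposite X) B (\<lambda>F. - l F)) i g) =
      bdry (dual_complex (face_complex X B l)) i (face_pairing X B (- i) g)"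
    for i and g :: "'p set \<Rightarrow> ('n, 'k::field) mpoly"
  proof
    fix x :: "'p set \<Rightarrow> ('n, 'k::field) mpoly"
    show "face_pairing X B (- (i - 1)) (bdry (face_complex (opposite X) B (\<lambda>F. - l F)) i g) x =
      bdry (dual_complex (face_complex X B l)) i (face_pairing X B (- i) g) x"
    proof (cases "x \<in> face_coeffs X B (1 - i)")
      case True
      then show ?thesis
        using face_pairing_bdry[OF B True, of g]
        unfolding dual_complex_simps face_complex_simps(1) face_module_simps(1)
        by (simp only: restrict_apply if_True minus_diff_eq)
    next
      case False
      then show ?thesis
        unfolding dual_complex_simps face_complex_simps(1) face_module_simps(1) face_pairing_def
        by (simp only: restrict_apply if_False minus_diff_eq)
    qed
  qed
  then show ?thesis
    unfolding complex_iso_def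
    by (simp only: dual_complex_simps(1) face_complex_simps(1) simp_thms ball_simps
        face_complex_graded[OF graded_incidence_opposite[OF B]] face_pairing_iso[OF fin]) simp
qed

section \<open>Functoriality of the graded dual\<close>

lemma homogeneous_functionals_compose:
  assumes f: "graded_iso N M f" and u: "u \<in> homogeneous_functionals M c"
  shows "(\<lambda>x\<in>carrier N. u (f x)) \<in> homogeneous_functionals N c"
proof -
  interpret N: Module.module polyring N
    using f graded_moduleD(1) by (auto simp: graded_iso_def)
  have s: "s \<in> carrier polyring" for s by (simp add: polyring_def)
  have sub: "x \<in> carrier N" if "x \<in> hcomp N d" for x d
    using f graded_moduleD(3)[of N d] that by (auto simp: graded_iso_def)
  have fc: "f x \<in> carrier M" if "x \<in> carrier N" for x
    using f that by (auto simp: graded_iso_def bij_betw_def)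
  have fh: "f x \<in> hcomp M d" if "x \<in> hcomp N d" for x d
    using f that unfolding graded_iso_def by blast
  show ?thesis
    using u f by (auto simp: homogeneous_functionals_def s sub fc fh graded_iso_def)
qed

lemma dual_graded_iso:
  assumes f: "graded_iso N M f" and D: "is_graded_module (dual_module M)"
  shows "graded_iso (dual_module M) (dual_module N) (\<lambda>u. \<lambda>x\<in>carrier N. u (f x))"
proof -
  let ?F = "\<lambda>u. \<lambda>x\<in>carrier N. u (f x)"
  let ?f' = "inv_into (carrier N) f"
  let ?G = "\<lambda>v. \<lambda>y\<in>carrier M. v (?f' y)"
  have M: "carrier M = f ` carrier N" and inj: "inj_on f (carrier N)"
    using f by (auto simp: graded_iso_def bij_betw_def)
  have f'f: "?f' (f x) = x" if "x \<in> carrier N" for x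
    using inj that by simp
  have FG: "?F (?G v) = v" if "v \<in> extensional (carrier N)" for v
    using that M f'f by (auto simp: extensional_def fun_eq_iff)
  have GF: "?G (?F u) = u" if "u \<in> extensional (carrier M)" for u
    using that M f'f by (auto simp: extensional_def fun_eq_iff)
  have hext: "u \<in> extensional (carrier M)" if "u \<in> homogeneous_functionals M c" for u c
    using that by (simp add: homogeneous_functionals_def)
  have hext': "u \<in> extensional (carrier N)" if "u \<in> homogeneous_functionals N c" for u c
    using that by (simp add: homogeneous_functionals_def)
  have F: "?F u \<in> homogeneous_functionals N c" if "u \<in> homogeneous_functionals M c" for u c
    using homogeneous_functionals_compose[OF f that] .
  have G: "?G v \<in> homogeneous_functionals M c" if "v \<in> homogeneous_functionals N c" for v c
    using homogeneous_functionals_compose[OF graded_iso_sym[OF f] that] .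
  have hc: "?F ` homogeneous_functionals M c = homogeneous_functionals N c" for c
  proof (intro equalityI subsetI)
    fix v assume v: "v \<in> homogeneous_functionals N c"
    show "v \<in> ?F ` homogeneous_functionals M c"
      by (rule image_eqI[where x = "?G v"], rule FG[OF hext'[OF v], symmetric], rule G[OF v])
  qed (use F in blast)
  have inj_F: "inj_on ?F (carrier (dual_module M))"
  proof (rule inj_onI)
    fix u v assume uv: "u \<in> carrier (dual_module M)" "v \<in> carrier (dual_module M)" "?F u = ?F v"
    then have ext: "u \<in> extensional (carrier M)" "v \<in> extensional (carrier M)"
      by auto
    have "u = ?G (?F u)" by (rule GF[OF ext(1), symmetric])
    also have "\<dots> = ?G (?F v)" by (simp only: uv(3))
    also have "\<dots> = v" by (rule GF[OF ext(2)])
    finally show "u = v" .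
  qed
  have "?F ` carrier (dual_module M) = carrier (dual_module N)"
  proof (intro equalityI subsetI)
    fix v assume "v \<in> ?F ` carrier (dual_module M)"
    then obtain A h where h: "finite A" "\<forall>c\<in>A. h c \<in> homogeneous_functionals M c"
      and v: "v = ?F (\<lambda>x \<in> carrier M. \<Sum>c\<in>A. h c x)"
      by auto
    have "v = (\<lambda>x \<in> carrier N. \<Sum>c\<in>A. ?F (h c) x)"
      unfolding v M by (rule restrict_ext) simp
    then show "v \<in> carrier (dual_module N)"
      unfolding dual_module_simps(1) mem_Collect_eq
      using h(1) h(2) F by (intro exI[of _ A] exI[of _ "\<lambda>c. ?F (h c)"] conjI) blast+
  next
    fix v assume "v \<in> carrier (dual_module N)"
    then obtain A h where h: "finite A" "\<forall>c\<in>A. h c \<in> homogeneous_functionals N c"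
      and v: "v = (\<lambda>x \<in> carrier N. \<Sum>c\<in>A. h c x)"
      by auto
    have "v = ?F (\<lambda>y \<in> carrier M. \<Sum>c\<in>A. ?G (h c) y)"
      unfolding v M by (rule restrict_ext) (simp add: f'f)
    moreover have "(\<lambda>y \<in> carrier M. \<Sum>c\<in>A. ?G (h c) y) \<in> carrier (dual_module M)"
      unfolding dual_module_simps(1) mem_Collect_eq
      using h(1) h(2) G by (intro exI[of _ A] exI[of _ "\<lambda>c. ?G (h c)"] conjI) blast+
    ultimately show "v \<in> ?F ` carrier (dual_module M)" by blast
  qed
  moreover have "f x \<in> carrier M" if "x \<in> carrier N" for x
    using that M by auto
  ultimately show ?thesis
    unfolding graded_iso_def bij_betw_def using D inj_F hc
    by (simp del: dual_module_simps(1) add: fun_eq_iff)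
qed

lemma dual_complex_iso:
  assumes f: "complex_iso D C f" and dC: "is_graded_complex (dual_complex C)"
  shows "complex_iso (dual_complex C) (dual_complex D)
    (\<lambda>i u. \<lambda>x\<in>carrier (chain D (- i)). u (f (- i) x))"
proof -
  have D: "is_graded_complex D" and iso: "\<And>i. graded_iso (chain D i) (chain C i) (f i)"
    and comm: "\<And>i x. x \<in> carrier (chain D i) \<Longrightarrow> bdry C i (f i x) = f (i - 1) (bdry D i x)"
    using f by (simp_all add: complex_iso_def)
  have bD: "bdry D i x \<in> carrier (chain D (i - 1))" if "x \<in> carrier (chain D i)" for i x
    using D that by (auto simp: is_graded_complex_def degree_zero_map_def linear_map_def)
  have fc: "f i x \<in> carrier (chain C i)" if "x \<in> carrier (chain D i)" for i x
    using iso[of i] that by (auto simp: graded_iso_def bij_betw_def)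
  have "(\<lambda>x\<in>carrier (chain D (- (i - 1))). bdry (dual_complex C) i u (f (- (i - 1)) x)) =
      bdry (dual_complex D) i (\<lambda>x\<in>carrier (chain D (- i)). u (f (- i) x))" for i u
  proof -
    have "bdry D (1 - i) x \<in> carrier (chain D (- i))"
      "bdry C (1 - i) (f (1 - i) x) = f (- i) (bdry D (1 - i) x)" if "x \<in> carrier (chain D (1 - i))" for x
      using bD[OF that] comm[OF that] by simp_all
    then show ?thesis
      by (auto simp: fun_eq_iff fc)
  qed
  moreover have "is_graded_module (dual_module (chain C (- i)))" for i
    using dC by (simp add: is_graded_complex_def)
  ultimately show ?thesis
    unfolding complex_iso_def using dC
    by (simp add: dual_graded_iso[OF iso] del: dual_complex_simps(2) dual_module_simps)
qed

section \<open>Quotients of face complexes\<close>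

lemma quotient_module_simps [simp]:
  "carrier (quotient_module M N) = a_rcosets\<^bsub>M\<^esub> (carrier N)"
  "zero (quotient_module M N) = carrier N"
  "add (quotient_module M N) = (<+>\<^bsub>M\<^esub>)"
  "module.smult (quotient_module M N) = (\<lambda>s A. \<Union>x\<in>A. carrier N +>\<^bsub>M\<^esub> (s \<odot>\<^bsub>M\<^esub> x))"
  "hcomp (quotient_module M N) c = (\<lambda>x. carrier N +>\<^bsub>M\<^esub> x) ` hcomp M c"
  by (simp_all add: quotient_module_def)

lemma quotient_complex_simps [simp]:
  "chain (quotient_complex C D) i = quotient_module (chain C i) (chain D i)"
  "bdry (quotient_complex C D) i A =
     (\<Union>x\<in>A. carrier (chain D (i - 1)) +>\<^bsub>chain C (i - 1)\<^esub> bdry C i x)"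
  by (simp_all add: quotient_complex_def)

text \<open>A coset modulo the chains on \<open>B'\<close> is the set of all chains with prescribed coefficients off \<open>B'\<close>.\<close>

definition face_coset :: "('p, 'n) cell_complex \<Rightarrow> 'p set set \<Rightarrow> 'p set set \<Rightarrow> int \<Rightarrow>
    ('p set \<Rightarrow> ('n, 'k::field) mpoly) \<Rightarrow> ('p set \<Rightarrow> ('n, 'k) mpoly) set" where
  "face_coset X B B' i g = {h \<in> face_coeffs X B i. \<forall>F\<in>B - B'. h F = g F}"

lemma face_coset_eq:
  fixes X :: "('p, 'n::finite) cell_complex" and g :: "'p set \<Rightarrow> ('n, 'k::field) mpoly"
  assumes "B' \<subseteq> B" "g \<in> face_coeffs X B i"
  shows "face_coeffs X B' i +>\<^bsub>face_module X B l i\<^esub> g = face_coset X B B' i g"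
proof (intro equalityI subsetI)
  fix h assume "h \<in> face_coeffs X B' i +>\<^bsub>face_module X B l i\<^esub> g"
  then obtain n where "n \<in> face_coeffs X B' i" "h = n + g"
    by (auto simp: a_r_coset_def')
  then show "h \<in> face_coset X B B' i g" using assms by (auto simp: face_coset_def)
next
  fix h assume h: "h \<in> face_coset X B B' i g"
  have "(h - g) F = 0" if "F \<in> B' \<longrightarrow> fdim X F \<noteq> i" for F
    using h assms that by (cases "F \<in> B") (auto simp: face_coset_def)
  then have "h - g \<in> face_coeffs X B' i" by simp
  moreover have "h = (h - g) + g" by simp
  ultimately show "h \<in> face_coeffs X B' i +>\<^bsub>face_module X B l i\<^esub> g"
    unfolding a_r_coset_def' face_module_simps by blast
qed

lemma face_coset_cong:
  "(\<And>F. F \<in> B - B' \<Longrightarrow> g F = h F) \<Longrightarrow> face_coset X B B' i g = face_coset X B B' i h"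
  by (auto simp: face_coset_def)

lemma face_coset_self: "g \<in> face_coeffs X B i \<Longrightarrow> g \<in> face_coset X B B' i g"
  by (simp add: face_coset_def)

text \<open>A path between faces outside a subcomplex stays outside, since a subcomplex cannot be left by
passing to faces. So the relevant sums do not change.\<close>

lemma graded_incidence_diff:
  assumes "graded_incidence X B l" "\<And>F G. F \<in> B' \<Longrightarrow> G \<in> B \<Longrightarrow> incidence X F G \<noteq> 0 \<Longrightarrow> G \<in> B'"
  shows "graded_incidence X (B - B') l"
proof -
  have "(\<Sum>G\<in>B - B'. incidence X F G * incidence X G H) = 0" if "F \<in> B - B'" "H \<in> B - B'" for F H
  proof -
    have "(\<Sum>G\<in>B - B'. incidence X F G * incidence X G H) = (\<Sum>G\<in>B. incidence X F G * incidence X G H)"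
      by (rule sum.mono_neutral_left) (use assms that in \<open>auto simp: graded_incidence_def\<close>)
    then show ?thesis using assms(1) that by (simp add: graded_incidence_def)
  qed
  then show ?thesis using assms(1) by (simp add: graded_incidence_def)
qed

lemma quotient_face_module_iso:
  fixes X :: "('p, 'n::finite) cell_complex"
  assumes B': "B' \<subseteq> B" and fin: "finite B"
  shows "graded_iso (face_module X (B - B') l i :: ('n, 'k::field, _) gmod)
    (quotient_module (face_module X B l i) (face_module X B' l i)) (face_coset X B B' i)"
proof -
  let ?Q = "quotient_module (face_module X B l i) (face_module X B' l i) :: ('n, 'k, _) gmod"
  let ?cos = "face_coset X B B' i :: _ \<Rightarrow> ('p set \<Rightarrow> ('n, 'k) mpoly) set"
  let ?res = "\<lambda>g F. if F \<in> B' then 0 else (g F :: ('n, 'k) mpoly)"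
  have sub: "x \<in> face_coeffs X B i" if "x \<in> face_coeffs X (B - B') i" for x :: "'p set \<Rightarrow> ('n, 'k) mpoly"
    using that by auto
  \<comment> \<open>Every coset has exactly one representative vanishing on \<open>B'\<close>.\<close>
  have res: "?cos x = ?cos (?res x)" "?res x \<in> face_coeffs X (B - B') i" if "x \<in> face_coeffs X B i" for x
    using that by (auto intro!: face_coset_cong)
  have inj: "inj_on ?cos (face_coeffs X (B - B') i)"
  proof (rule inj_onI)
    fix g h :: "'p set \<Rightarrow> ('n, 'k) mpoly"
    assume gh: "g \<in> face_coeffs X (B - B') i" "h \<in> face_coeffs X (B - B') i" "?cos g = ?cos h"
    have "g \<in> ?cos g" by (rule face_coset_self[OF sub[OF gh(1)]])
    then have "g \<in> ?cos h" by (simp only: gh(3))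
    then have "g F = h F" if "F \<in> B - B'" for F
      using that by (simp add: face_coset_def)
    moreover have "g F = h F" if "F \<notin> B - B'" for F
    proof -
      have "g F = 0" "h F = 0" using gh(1,2) that by blast+
      then show ?thesis by simp
    qed
    ultimately show "g = h" by blast
  qed
  have car: "?cos ` face_coeffs X (B - B') i = carrier ?Q"
  proof -
    have "carrier ?Q = ?cos ` face_coeffs X B i"
      using face_coset_eq[OF B', of _ X i l] by (auto simp: A_RCOSETS_def')
    also have "\<dots> = ?cos ` face_coeffs X (B - B') i"
    proof (intro equalityI image_subsetI)
      fix x :: "'p set \<Rightarrow> ('n, 'k) mpoly" assume "x \<in> face_coeffs X B i"
      then show "?cos x \<in> ?cos ` face_coeffs X (B - B') i"
        by (intro image_eqI[of _ _ "?res x"] res)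
    qed (rule imageI, rule sub)
    finally show ?thesis ..
  qed
  have zero: "?cos 0 = face_coeffs X B' i"
    using B' by (auto simp: face_coset_def)
  have add: "?cos (x + y) = ?cos x \<oplus>\<^bsub>?Q\<^esub> ?cos y"
    if "x \<in> face_coeffs X (B - B') i" "y \<in> face_coeffs X (B - B') i" for x y
  proof (intro equalityI subsetI)
    fix h assume h: "h \<in> ?cos (x + y)"
    then have "h - y \<in> ?cos x" "y \<in> ?cos y" using that by (auto simp: face_coset_def)
    moreover have "h = (h - y) + y" by simp
    ultimately show "h \<in> ?cos x \<oplus>\<^bsub>?Q\<^esub> ?cos y"
      unfolding quotient_module_simps set_add_def' face_module_simps by blast
  next
    fix h assume "h \<in> ?cos x \<oplus>\<^bsub>?Q\<^esub> ?cos y"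
    then show "h \<in> ?cos (x + y)"
      by (auto simp: set_add_def' face_coset_def)
  qed
  have smult: "?cos (\<lambda>F. s * x F) = s \<odot>\<^bsub>?Q\<^esub> ?cos x"
    if x: "x \<in> face_coeffs X (B - B') i" for s x
  proof -
    have "s \<odot>\<^bsub>?Q\<^esub> ?cos x = (\<Union>y\<in>?cos x. face_coeffs X B' i +>\<^bsub>face_module X B l i\<^esub> (\<lambda>F. s * y F))"
      by simp
    also have "\<dots> = (\<Union>y\<in>?cos x. ?cos (\<lambda>F. s * x F))"
    proof (rule SUP_cong[OF refl])
      fix y assume y: "y \<in> ?cos x"
      then have "(\<lambda>F. s * y F) \<in> face_coeffs X B i" by (auto simp: face_coset_def)
      then have "face_coeffs X B' i +>\<^bsub>face_module X B l i\<^esub> (\<lambda>F. s * y F) = ?cos (\<lambda>F. s * y F)"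
        by (rule face_coset_eq[OF B'])
      also have "\<dots> = ?cos (\<lambda>F. s * x F)"
        by (rule face_coset_cong) (use y in \<open>auto simp: face_coset_def\<close>)
      finally show "face_coeffs X B' i +>\<^bsub>face_module X B l i\<^esub> (\<lambda>F. s * y F) = ?cos (\<lambda>F. s * x F)" .
    qed
    also have "\<dots> = ?cos (\<lambda>F. s * x F)"
      using face_coset_self[OF sub[OF x]] by blast
    finally show ?thesis ..
  qed
  have hc: "?cos ` hcomp (face_module X (B - B') l i) c = hcomp ?Q c" for c
  proof -
    have "hcomp ?Q c = ?cos ` hcomp (face_module X B l i) c"
      unfolding quotient_module_simps
      by (rule image_cong[OF refl], unfold face_module_simps(1), rule face_coset_eq[OF B'])
        (simp add: hcomp_face_module)
    also have "\<dots> = ?cos ` hcomp (face_module X (B - B') l i) c"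
    proof (intro equalityI image_subsetI)
      fix x :: "'p set \<Rightarrow> ('n, 'k) mpoly" assume x: "x \<in> hcomp (face_module X B l i) c"
      then have "?res x \<in> hcomp (face_module X (B - B') l i) c"
        by (auto simp: hcomp_face_module poly_comp_0)
      moreover have "?cos x = ?cos (?res x)"
        by (rule res(1)) (use x in \<open>simp add: hcomp_face_module\<close>)
      ultimately show "?cos x \<in> ?cos ` hcomp (face_module X (B - B') l i) c" by blast
    next
      fix x :: "'p set \<Rightarrow> ('n, 'k) mpoly" assume "x \<in> hcomp (face_module X (B - B') l i) c"
      then have "x \<in> hcomp (face_module X B l i) c" by (auto simp: hcomp_face_module)
      then show "?cos x \<in> ?cos ` hcomp (face_module X B l i) c" by (rule imageI)
    qed
    finally show ?thesis ..
  qed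
  have gr: "is_graded_module (face_module X (B - B') l i :: ('n, 'k, _) gmod)"
    by (rule face_module_graded) (use fin in simp)
  show ?thesis
    unfolding graded_iso_def bij_betw_def face_module_simps
  proof (intro conjI ballI allI)
    show "?cos 0 = \<zero>\<^bsub>?Q\<^esub>" by (simp only: zero quotient_module_simps(2) face_module_simps(1))
  qed (rule gr inj car add smult hc | assumption)+
qed

lemma face_complex_bdry_diff:
  assumes "B' \<subseteq> B" "\<And>F G. F \<in> B' \<Longrightarrow> G \<in> B \<Longrightarrow> incidence X F G \<noteq> 0 \<Longrightarrow> G \<in> B'"
    and "finite B" "H \<in> B - B'" "\<And>F. F \<in> B - B' \<Longrightarrow> g F = h F"
  shows "bdry (face_complex X B l) i g H = bdry (face_complex X (B - B') l) i h H"
proof -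
  have "(\<Sum>F \<in> {F \<in> B. fdim X F = i}. g F * bdry_coeff X l F H) =
      (\<Sum>F \<in> {F \<in> B - B'. fdim X F = i}. g F * bdry_coeff X l F H)"
  proof (rule sum.mono_neutral_right)
    show "\<forall>F\<in>{F \<in> B. fdim X F = i} - {F \<in> B - B'. fdim X F = i}. g F * bdry_coeff X l F H = 0"
    proof
      fix F assume "F \<in> {F \<in> B. fdim X F = i} - {F \<in> B - B'. fdim X F = i}"
      then have "incidence X F H = 0" using assms(2)[of F H] assms(4) by blast
      then show "g F * bdry_coeff X l F H = 0" by simp
    qed
  qed (use assms(3) in auto)
  also have "\<dots> = (\<Sum>F \<in> {F \<in> B - B'. fdim X F = i}. h F * bdry_coeff X l F H)"
    by (rule sum.cong) (use assms in auto)
  finally show ?thesis using assms(4) by simp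
qed

text \<open>The quotient by a subcomplex is free on the remaining faces. Its boundary map is well defined
and given by the remaining incidences because coefficients on \<open>B'\<close> only contribute to
coefficients on \<open>B'\<close>.\<close>

lemma quotient_face_complex_iso:
  fixes X :: "('p, 'n::finite) cell_complex"
  assumes B: "graded_incidence X B l" and B': "B' \<subseteq> B"
    and closed: "\<And>F G. F \<in> B' \<Longrightarrow> G \<in> B \<Longrightarrow> incidence X F G \<noteq> 0 \<Longrightarrow> G \<in> B'"
  shows "complex_iso (face_complex X (B - B') l :: ('n, 'k::field, _) gcpx)
    (quotient_complex (face_complex X B l) (face_complex X B' l)) (face_coset X B B')"
proof -
  let ?C = "face_complex X B l :: ('n, 'k, _) gcpx"
  have fin: "finite B" using B by (simp add: graded_incidence_def)
  have "face_coset X B B' (i - 1) (bdry (face_complex X (B - B') l) i g) =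
      bdry (quotient_complex ?C (face_complex X B' l)) i (face_coset X B B' i g)"
    if g: "g \<in> face_coeffs X (B - B') i" for i and g :: "'p set \<Rightarrow> ('n, 'k) mpoly"
  proof -
    let ?dg = "bdry (face_complex X (B - B') l) i g"
    have "face_coeffs X B' (i - 1) +>\<^bsub>face_module X B l (i - 1)\<^esub> bdry ?C i h =
        face_coset X B B' (i - 1) ?dg" if h: "h \<in> face_coset X B B' i g" for h
    proof -
      have "bdry ?C i h \<in> face_coeffs X B (i - 1)"
        using face_complex_bdry_carrier[OF B, of i h] by (simp only: face_module_simps)
      then have "face_coeffs X B' (i - 1) +>\<^bsub>face_module X B l (i - 1)\<^esub> bdry ?C i h =
          face_coset X B B' (i - 1) (bdry ?C i h)"
        by (rule face_coset_eq[OF B'])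
      also have "\<dots> = face_coset X B B' (i - 1) ?dg"
        by (rule face_coset_cong, rule face_complex_bdry_diff[OF B' closed fin])
          (use h in \<open>auto simp: face_coset_def\<close>)
      finally show ?thesis .
    qed
    moreover have "g \<in> face_coset X B B' i g"
      by (rule face_coset_self) (use g in auto)
    ultimately show ?thesis
      unfolding quotient_complex_simps face_complex_simps(1) face_module_simps(1) by blast
  qed
  then show ?thesis
    unfolding complex_iso_def
    by (simp only: quotient_complex_simps(1) face_complex_simps(1) simp_thms ball_simps
        face_complex_graded[OF graded_incidence_diff[OF B closed]] quotient_face_module_iso[OF B' fin]
        face_module_simps(1)) blast
qed

section \<open>Labels and incidences of regular cell complexes\<close>

lemma closed_ball_not_open:
  assumes "0 < d"
  shows "\<exists>p \<in> topspace (closed_ball_space d). p \<notin> open_ball_set d"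
proof -
  \<comment> \<open>The first unit vector, which exists as \<open>d > 0\<close>.\<close>
  let ?p = "\<lambda>i::nat. if i = 0 then 1 else (0::real)"
  have "(\<Sum>i<d. (?p i)\<^sup>2) = (\<Sum>i<d. if i = 0 then 1 else 0)"
    by (rule sum.cong) auto
  also have "\<dots> = 1" using assms by simp
  finally have "(\<Sum>i<d. (?p i)\<^sup>2) = 1" .
  then have "?p \<in> topspace (closed_ball_space d)" "?p \<notin> open_ball_set d"
    using assms by (simp_all add: closed_ball_space_def open_ball_set_def topspace_Euclidean_space)
  then show ?thesis by blast
qed

lemma face_subset_closure:
  assumes "regular_cell_complex X" "F \<in> faces X"
  shows "F \<subseteq> space X closure_of F"
  using assms by (intro closure_of_subset) (auto simp: regular_cell_complex_def)

lemma face_of_trans: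
  assumes "face_of X H G" "face_of X G F"
  shows "face_of X H F"
proof -
  have "space X closure_of G \<subseteq> space X closure_of F"
    using assms(2) closure_of_mono[of G "space X closure_of F" "space X"]
    by (simp add: face_of_def closure_of_closure_of)
  then show ?thesis using assms by (auto simp: face_of_def)
qed

lemma regular_cell_complex_cell:
  assumes X: "regular_cell_complex X" and F: "F \<in> faces X" "F \<noteq> {}"
  obtains d h where "fdim X F = int d"
    "homeomorphic_map (closed_ball_space d) (subtopology (space X) (space X closure_of F)) h"
    "h ` open_ball_set d = F"
    "space X closure_of F - F = \<Union> {G \<in> faces X. G \<subseteq> space X closure_of F \<and> fdim X G < fdim X F}"
proof -
  have "F \<in> faces X - {{}}" using F by simp
  note cell = bspec[OF X[unfolded regular_cell_complex_def, THEN conjunct2, THEN conjunct2, THEN conjunct2,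
      THEN conjunct2, THEN conjunct2, THEN conjunct2] this]
  from cell[THEN conjunct1] obtain d h where "fdim X F = int d"
    "homeomorphic_map (closed_ball_space d) (subtopology (space X) (space X closure_of F)) h"
    "h ` open_ball_set d = F" by (elim exE conjE)
  then show ?thesis using cell[THEN conjunct2] by (rule that)
qed

text \<open>A closed ball of positive dimension has a boundary point. Its image in the closed cell avoids the
open cell, so it lies in a face of smaller dimension.\<close>

lemma regular_cell_complex_facet:
  assumes X: "regular_cell_complex X" and F: "F \<in> faces X" "fdim X F > 0"
  shows "\<exists>G. face_of X G F \<and> G \<noteq> {} \<and> fdim X G < fdim X F"
proof -
  let ?cl = "space X closure_of F"
  have "F \<noteq> {}" using X F by (auto simp: regular_cell_complex_def)
  obtain d h where d: "fdim X F = int d"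
    and h: "homeomorphic_map (closed_ball_space d) (subtopology (space X) ?cl) h"
    and hF: "h ` open_ball_set d = F"
    and bd: "?cl - F = \<Union> {G \<in> faces X. G \<subseteq> ?cl \<and> fdim X G < fdim X F}"
    by (rule regular_cell_complex_cell[OF X F(1) \<open>F \<noteq> {}\<close>])
  have "0 < d" using d F(2) by simp
  then obtain p where p: "p \<in> topspace (closed_ball_space d)" "p \<notin> open_ball_set d"
    using closed_ball_not_open by blast
  have "h p \<notin> F"
  proof
    assume "h p \<in> F"
    then obtain q where q: "q \<in> open_ball_set d" "h p = h q" using hF by blast
    moreover have "q \<in> topspace (closed_ball_space d)"
      using q(1) by (simp add: open_ball_set_def closed_ball_space_def)
    ultimately have "p = q"
      using inj_onD[OF homeomorphic_imp_injective_map[OF h]] p(1) by blast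
    then show False using p(2) q(1) by simp
  qed
  moreover have "h p \<in> ?cl"
    using homeomorphic_imp_surjective_map[OF h] p(1) by auto
  ultimately obtain G where "G \<in> faces X" "G \<subseteq> ?cl" "fdim X G < fdim X F" "h p \<in> G"
    using bd by blast
  then show ?thesis using F by (auto simp: face_of_def)
qed

lemma regular_cell_complex_vertex:
  assumes X: "regular_cell_complex X" and F: "F \<in> faces X" "F \<noteq> {}"
  shows "\<exists>v. face_of X v F \<and> fdim X v = 0"
  using F
proof (induction "nat (fdim X F)" arbitrary: F rule: less_induct)
  case less
  have nonneg: "fdim X G \<ge> 0" if "G \<in> faces X" "G \<noteq> {}" for G
    by (rule regular_cell_complex_cell[OF X that]) simp
  show ?case
  proof (cases "fdim X F = 0")
    case True
    then show ?thesis using less.prems face_subset_closure[OF X] by (auto simp: face_of_def)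
  next
    case False
    then obtain G where G: "face_of X G F" "G \<noteq> {}" "fdim X G < fdim X F"
      using regular_cell_complex_facet[OF X less.prems(1)] nonneg[OF less.prems] by auto
    then have "G \<in> faces X" by (simp add: face_of_def)
    then obtain v where "face_of X v G" "fdim X v = 0"
      using less.hyps[of G] G nonneg[of G] by auto
    then show ?thesis using face_of_trans G(1) by blast
  qed
qed

text \<open>Vertices of a face of \<open>F\<close> are vertices of \<open>F\<close>. The maximum is monotone in the index set only for
nonempty sets, which is where the existence of a vertex enters.\<close>

lemma label_mono:
  assumes X: "regular_cell_complex X" and GF: "face_of X G F" and "G \<noteq> {}" "F \<noteq> {}"
  shows "label X G \<le> label X F"
proof -
  have G: "G \<in> faces X" using GF by (simp add: face_of_def)
  let ?V = "\<lambda>F. {v. face_of X v F \<and> fdim X v = 0}"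
  have "finite (?V F)"
    by (rule finite_subset[of _ "faces X"]) (use X in \<open>auto simp: face_of_def regular_cell_complex_def\<close>)
  moreover have "?V G \<noteq> {}" using regular_cell_complex_vertex[OF X G] assms(3) by blast
  moreover have "?V G \<subseteq> ?V F" using face_of_trans GF by blast
  ultimately show ?thesis
    using assms(3,4) by (auto simp: label_def le_fun_def intro!: Max_mono image_mono)
qed

lemma label_incidence_mono:
  assumes X: "labelled_regular_cell_complex X" and nn: "\<forall>F \<in> faces X. 0 \<le> label X F"
    and FG: "F \<in> faces X" "G \<in> faces X" "incidence X F G \<noteq> 0"
  shows "label X G \<le> label X F"
proof (cases "G = {}")
  case True
  then show ?thesis using nn FG by (simp add: label_def)
next
  case False
  have "face_of X G F"
    using X FG by (auto simp: labelled_regular_cell_complex_def incidence_function_def)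
  moreover from this have "F \<noteq> {}" using False by (auto simp: face_of_def)
  ultimately show ?thesis
    using label_mono False X by (auto simp: labelled_regular_cell_complex_def)
qed

lemma graded_incidence_faces:
  assumes X: "labelled_regular_cell_complex X"
    and l: "\<And>F G. F \<in> faces X \<Longrightarrow> G \<in> faces X \<Longrightarrow> incidence X F G \<noteq> 0 \<Longrightarrow> l G \<le> l F"
  shows "graded_incidence X (faces X) l"
proof -
  have I: "incidence_function X" and fin: "finite (faces X)"
    using X by (auto simp: labelled_regular_cell_complex_def regular_cell_complex_def)
  have dim: "fdim X G = fdim X F - 1" if "F \<in> faces X" "G \<in> faces X" "incidence X F G \<noteq> 0" for F G
    using I that by (auto simp: incidence_function_def)
  have "(\<Sum>G\<in>faces X. incidence X F G * incidence X G H) = 0" if "F \<in> faces X" "H \<in> faces X" for F H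
  proof (cases "fdim X H = fdim X F - 2")
    case True
    then show ?thesis using I that unfolding incidence_function_def by blast
  next
    case False
    show ?thesis
    proof (rule sum.neutral, rule ballI, rule ccontr)
      fix G assume "G \<in> faces X" "incidence X F G * incidence X G H \<noteq> 0"
      then show False using dim[of F G] dim[of G H] that False by simp
    qed
  qed
  then show ?thesis using fin dim l by (simp add: graded_incidence_def)
qed

section \<open>The relative dual complex\<close>

text \<open>Removing \<open>{}\<close> from the faces and then \<open>Y\<close> leaves the faces outside \<open>Y\<close>, so the quotient complex is
their face complex and its dual is the opposite one.\<close>

lemma relative_dual_iso:
  fixes X :: "('p, 'n::finite) cell_complex"
  assumes B: "graded_incidence X (faces X - {{}}) (label X)" and Y: "Y \<subseteq> faces X" "{} \<in> Y"
    and closed: "\<And>F G. F \<in> Y \<Longrightarrow> G \<in> faces X \<Longrightarrow> incidence X F G \<noteq> 0 \<Longrightarrow> G \<in> Y"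
  shows "\<exists>\<psi>. complex_iso (face_complex (opposite X) (faces X - Y) (\<lambda>F. - label X F) :: ('n, 'k::field, _) gcpx)
      (relative_dual_complex X Y) \<psi> \<and>
    (\<forall>F \<in> faces X - Y. \<psi> (- fdim X F) (face_vector F) = relative_dual_basis X Y F)"
proof -
  let ?B = "faces X - {{}}" and ?B' = "Y - {{}}" and ?Q = "faces X - Y"
  let ?C = "face_complex X ?Q (label X) :: ('n, 'k, _) gcpx"
  let ?K = "face_complex (opposite X) ?Q (\<lambda>F. - label X F) :: ('n, 'k, _) gcpx"
  let ?R = "quotient_complex (cellular_complex X (faces X)) (cellular_complex X Y) :: ('n, 'k, _) gcpx"
  let ?f = "\<lambda>i. inv_into (face_coeffs X ?Q i) (face_coset X ?B ?B' i) :: _ \<Rightarrow> 'p set \<Rightarrow> ('n, 'k) mpoly"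
  define \<psi> :: "int \<Rightarrow> ('p set \<Rightarrow> ('n, 'k) mpoly) \<Rightarrow> ('p set \<Rightarrow> ('n, 'k) mpoly) set \<Rightarrow> ('n, 'k) mpoly"
    where "\<psi> = (\<lambda>i g. \<lambda>A\<in>carrier (chain ?R (- i)). face_pairing X ?Q (- i) g (?f (- i) A))"
  have Q: "?B - ?B' = ?Q" using Y by auto
  have fin: "finite ?Q" using B by (simp add: graded_incidence_def)
  have closed': "\<And>F G. F \<in> ?B' \<Longrightarrow> G \<in> ?B \<Longrightarrow> incidence X F G \<noteq> 0 \<Longrightarrow> G \<in> ?B'"
    using closed by blast
  have sub: "?B' \<subseteq> ?B" using Y by auto
  have giQ: "graded_incidence X ?Q (label X)"
    using graded_incidence_diff[OF B closed'] unfolding Q .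
  have q: "complex_iso ?C ?R (face_coset X ?B ?B')"
    unfolding cellular_complex_def
    by (rule quotient_face_complex_iso[OF B sub closed', unfolded Q])
  have p: "complex_iso ?K (dual_complex ?C) (\<lambda>i. face_pairing X ?Q (- i))"
    by (rule face_pairing_complex_iso[OF giQ])
  have qs: "complex_iso ?R ?C ?f"
    using complex_iso_sym[OF q] by (simp only: face_complex_simps(1) face_module_simps(1))
  have "complex_iso ?K (relative_dual_complex X Y) \<psi>"
    unfolding relative_dual_complex_def \<psi>_def
    by (rule complex_iso_trans[OF p dual_complex_iso[OF qs complex_iso_graded[OF p]]])
  moreover have "\<psi> (- fdim X F) (face_vector F) = relative_dual_basis X Y F" if F: "F \<in> ?Q" for F
  proof -
    have "face_pairing X ?Q (fdim X F) (face_vector F) (?f (fdim X F) A) = the_elem ((\<lambda>g. g F) ` A)"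
      if A: "A \<in> carrier (chain ?R (fdim X F))" for A
    proof -
      have "graded_iso (chain ?C (fdim X F)) (chain ?R (fdim X F)) (face_coset X ?B ?B' (fdim X F))"
        by (rule q[unfolded complex_iso_def, THEN conjunct2, THEN spec, THEN conjunct1])
      then have bij: "bij_betw (face_coset X ?B ?B' (fdim X F)) (face_coeffs X ?Q (fdim X F))
          (carrier (chain ?R (fdim X F)))"
        by (simp only: graded_iso_def face_complex_simps(1) face_module_simps(1))
      then obtain g where g: "g \<in> face_coeffs X ?Q (fdim X F)" "A = face_coset X ?B ?B' (fdim X F) g"
        using A unfolding bij_betw_def by blast
      have "?f (fdim X F) A = g"
        using bij_betw_inv_into_left[OF bij g(1)] g(2) by simp
      then have "face_pairing X ?Q (fdim X F) (face_vector F) (?f (fdim X F) A) = g F"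
        using g(1) by (simp only: face_pairing_face_vector_left[OF fin F refl] restrict_apply if_True)
      moreover have "(\<lambda>g. g F) ` A = {g F}"
      proof -
        have "g \<in> face_coset X ?B ?B' (fdim X F) g"
          by (rule face_coset_self) (use g(1) Y in auto)
        moreover have "h F = g F" if "h \<in> A" for h
        proof -
          have "\<forall>F\<in>?B - ?B'. h F = g F"
            using that unfolding g(2) face_coset_def mem_Collect_eq by (rule conjunct2)
          then show ?thesis using F unfolding Q by simp
        qed
        ultimately show ?thesis using g(2) by blast
      qed
      ultimately show ?thesis by simp
    qed
    then show ?thesis
      unfolding \<psi>_def relative_dual_basis_def minus_minus by (rule restrict_ext)
  qed
  ultimately show ?thesis by blast
qed

section \<open>The inverse limit\<close>

lemma shift_label_mono:
  assumes "0 \<le> b" "c \<le> d"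
  shows "shift_label b c \<le> shift_label b d"
  unfolding le_fun_def shift_label_def
proof
  fix i
  have "0 \<le> b i" "c i \<le> d i" using assms by (auto simp: le_fun_def)
  then show "(if c i \<le> 0 then c i - b i else c i) \<le> (if d i \<le> 0 then d i - b i else d i)" by simp
qed

lemma shift_label_positive: "1 \<le> c \<Longrightarrow> shift_label b c = c"
  unfolding shift_label_def le_fun_def
proof
  fix i assume "\<forall>i. 1 i \<le> c i"
  then have "1 \<le> c i" by simp
  then show "(if c i \<le> 0 then c i - b i else c i) = c i" by simp
qed

lemma limit_module_simps [simp]:
  "carrier (limit_module M \<phi>) = {s. \<exists>A h. finite A \<and> (\<forall>c \<in> A. h c \<in> limit_comp M \<phi> c) \<and>
                        s = (\<lambda>t. finsum (M t) (\<lambda>c. h c t) A)}"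
  "zero (limit_module M \<phi>) = (\<lambda>t. \<zero>\<^bsub>M t\<^esub>)"
  "add (limit_module M \<phi>) = (\<lambda>s s'. \<lambda>t. s t \<oplus>\<^bsub>M t\<^esub> s' t)"
  "module.smult (limit_module M \<phi>) = (\<lambda>p s. \<lambda>t. p \<odot>\<^bsub>M t\<^esub> s t)"
  "hcomp (limit_module M \<phi>) = limit_comp M \<phi>"
  by (simp_all add: limit_module_def)

lemma limit_complex_simps [simp]:
  "chain (limit_complex C \<phi>) i = limit_module (\<lambda>t. chain (C t) i) (\<lambda>t t'. \<phi> t t' i)"
  "bdry (limit_complex C \<phi>) i s = (\<lambda>t. bdry (C t) i (s t))"
  by (simp_all add: limit_complex_def)

lemma finsum_face_pairing:
  fixes X :: "('p, 'n::finite) cell_complex" and g :: "_ \<Rightarrow> 'p set \<Rightarrow> ('n, 'k::field) mpoly"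
  assumes "finite B" "finite A" "g \<in> A \<rightarrow> face_coeffs X B (- i)"
  shows "finsum (dual_module (face_module X B l (- i))) (\<lambda>c. face_pairing X B (- i) (g c)) A =
    face_pairing X B (- i) (sum g A)"
proof -
  have g: "g \<in> A \<rightarrow> carrier (face_module (opposite X) B (\<lambda>F. - l F) i)"
    using assms(3) unfolding carrier_face_module_opposite .
  show ?thesis
    by (simp only: graded_iso_finsum[OF face_pairing_iso[OF assms(1)] assms(2) g, symmetric]
        finsum_face_module[OF assms(2) g])
qed

text \<open>Evaluating at the basis vectors turns the sum over faces that defines the transition map into a
pairing, with the monomials absorbed into the coefficients.\<close>

lemma transition_face_pairing:
  fixes X :: "('p, 'n::finite) cell_complex" and g :: "'p set \<Rightarrow> ('n, 'k::field) mpoly"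
  assumes "finite (faces X)"
  shows "transition X b b' i (face_pairing X (faces X) (- i) g) =
    face_pairing X (faces X) (- i) (\<lambda>F. g F * monomial_of (label X F - shift_label (b - b') (label X F)))"
proof -
  have "(\<Sum>F\<in>{F \<in> faces X. fdim X F = - i}. face_pairing X (faces X) (- i) g (face_vector F) *
          monomial_of (label X F - shift_label (b - b') (label X F)) * shifted_dual_basis b' X F h) =
      (\<Sum>F\<in>{F \<in> faces X. fdim X F = - i}. g F *
          monomial_of (label X F - shift_label (b - b') (label X F)) * h F)"
    if h: "h \<in> face_coeffs X (faces X) (- i)" for h :: "'p set \<Rightarrow> ('n, 'k) mpoly"
  proof (rule sum.cong[OF refl])
    fix F assume F: "F \<in> {F \<in> faces X. fdim X F = - i}"
    have "shifted_dual_basis b' X F h = h F"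
      using h F by (simp add: shifted_dual_basis_def shifted_complex_def)
    moreover have "face_pairing X (faces X) (- i) g (face_vector F) = g F"
      using F by (intro face_pairing_face_vector[OF assms]) auto
    ultimately show "face_pairing X (faces X) (- i) g (face_vector F) *
          monomial_of (label X F - shift_label (b - b') (label X F)) * shifted_dual_basis b' X F h =
        g F * monomial_of (label X F - shift_label (b - b') (label X F)) * h F" by simp
  qed
  then show ?thesis
    unfolding transition_def shifted_complex_def face_complex_simps(1) face_module_simps(1)
    by (subst (2) face_pairing_def) (rule restrict_ext)
qed

text \<open>The heart of the matter: in each multidegree, compatible families of functionals are constant, and
their coefficients are supported on the faces outside \<open>X_U\<close>.\<close>

lemma limit_comp_duals:
  fixes X :: "('p, 'n::finite) cell_complex"
  assumes fin: "finite (faces X)" and nn: "\<forall>F \<in> faces X. 0 \<le> label X F"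
  shows "(\<lambda>g t. face_pairing X (faces X) (- i) g) `
      hcomp (face_module (opposite X) (faces X - X_U X) (\<lambda>F. - label X F) i) c =
    limit_comp (\<lambda>t. dual_module (face_module X (faces X) (\<lambda>F. shift_label (const_vec t) (label X F)) (- i)) ::
       ('n, 'k::field, _) gmod)
      (\<lambda>t t'. transition X (const_vec t) (const_vec t') i) c" (is "?L = ?R")
proof (intro equalityI subsetI)
  let ?lt = "\<lambda>t F. shift_label (const_vec t) (label X F)"
  let ?M = "\<lambda>t. face_module (opposite X) (faces X) (\<lambda>F. - ?lt t F) i :: ('n, 'k, _) gmod"
  let ?K = "face_module (opposite X) (faces X - X_U X) (\<lambda>F. - label X F) i :: ('n, 'k, _) gmod"
  let ?f = "face_pairing X (faces X) (- i) :: _ \<Rightarrow> _ \<Rightarrow> ('n, 'k) mpoly"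
  have pos: "shift_label b (label X F) = label X F" if "F \<in> faces X - X_U X" for b F
    using that by (intro shift_label_positive) (simp add: X_U_def)
  have hom: "?f ` hcomp (?M t) c = homogeneous_functionals (face_module X (faces X) (?lt t) (- i)) c" for t
    by (rule homogeneous_functionals_face_module[OF fin])
  {
    fix s assume "s \<in> ?L"
    then obtain g where g: "g \<in> hcomp ?K c" and s: "s = (\<lambda>t. ?f g)" by blast
    have gQ: "g F = 0" if "F \<notin> faces X - X_U X" for F
      using g that unfolding hcomp_face_module carrier_face_module_opposite by blast
    have "g \<in> hcomp (?M t) c" for t
    proof -
      have "g F \<in> poly_comp (c - - ?lt t F)" for F
      proof (cases "F \<in> faces X - X_U X")
        case True
        then show ?thesis using g pos[OF True] by (simp add: hcomp_face_module)
      qed (simp add: gQ poly_comp_0)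
      then show ?thesis using g by (auto simp: hcomp_face_module)
    qed
    then have "?f g \<in> homogeneous_functionals (face_module X (faces X) (?lt t) (- i)) c" for t
      using hom by blast
    moreover have "(\<lambda>F. g F * monomial_of (label X F - shift_label b (label X F))) = g" for b
    proof
      fix F
      show "g F * monomial_of (label X F - shift_label b (label X F)) = g F"
        by (cases "F \<in> faces X - X_U X") (simp_all add: pos gQ monomial_of_0)
    qed
    ultimately show "s \<in> ?R"
      by (simp add: limit_comp_def s transition_face_pairing[OF fin])
  }
  fix s :: "nat \<Rightarrow> ('p set \<Rightarrow> ('n, 'k) mpoly) \<Rightarrow> ('n, 'k) mpoly"
  assume s: "s \<in> ?R"
  then have "s t \<in> ?f ` hcomp (?M t) c" for t
    unfolding hom by (simp add: limit_comp_def)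
  then have "\<forall>t. \<exists>g. g \<in> hcomp (?M t) c \<and> s t = ?f g" by blast
  then obtain g where g: "\<And>t. g t \<in> hcomp (?M t) c" "\<And>t. s t = ?f (g t)" by metis
  have gc: "g t \<in> face_coeffs X (faces X) (- i)" for t
    using g(1)[of t] by (simp only: hcomp_face_module carrier_face_module_opposite) blast
  have compat: "g t F * monomial_of (label X F - shift_label (const_vec t - const_vec t') (label X F)) = g t' F"
    if "t' \<le> t" for t t' F
  proof -
    let ?g = "\<lambda>F. g t F * monomial_of (label X F - shift_label (const_vec t - const_vec t') (label X F))"
    have "transition X (const_vec t) (const_vec t') i (s t) = s t'"
      using s that unfolding limit_comp_def by blast
    then have eq: "?f ?g = ?f (g t')"
      unfolding g(2) transition_face_pairing[OF fin] .
    have mem: "?g \<in> face_coeffs X (faces X) (- i)" using gc[of t] by simp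
    have "?g = g t'" by (rule face_pairing_inj[OF fin mem gc eq])
    then show ?thesis by (rule fun_cong)
  qed
  have zero: "g t F = 0" if F: "F \<in> X_U X" for t F
  proof -
    from F obtain k where "F \<in> faces X" "\<not> 1 \<le> label X F k"
      by (auto simp: X_U_def le_fun_def)
    with nn have k: "label X F k = 0"
      by (auto simp: le_fun_def) (metis int_one_le_iff_zero_less order_le_less)
    \<comment> \<open>A stage late enough for the degree of \<open>g T F\<close> to be negative in the coordinate \<open>k\<close>.\<close>
    define T where "T = max t (nat (c k) + 1)"
    have "c k < int T" by (auto simp: T_def)
    then have "(c - - ?lt T F) k < 0" using k by (simp add: shift_label_def)
    moreover have "g T F \<in> poly_comp (c - - ?lt T F)"
      using g(1)[of T] unfolding hcomp_face_module by blast
    ultimately have "g T F = 0" by (rule poly_comp_negative[rotated])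
    moreover have "t \<le> T" by (simp add: T_def)
    ultimately show ?thesis using compat[of t T F] by simp
  qed
  \<comment> \<open>At faces outside \<open>X_U\<close> the comparison with stage \<open>0\<close> is multiplication by the monomial \<open>1\<close>.\<close>
  have const: "g t = g 0" for t
  proof
    fix F
    show "g t F = g 0 F"
    proof (cases "F \<in> faces X - X_U X")
      case True
      then show ?thesis using compat[of 0 t F] pos[OF True] by (simp add: monomial_of_0)
    next
      case False
      then show ?thesis using zero gc by (cases "F \<in> faces X") auto
    qed
  qed
  have "g 0 \<in> hcomp ?K c"
  proof -
    have "g 0 \<in> carrier ?K"
      using gc[of 0] zero[of _ 0] unfolding carrier_face_module_opposite by auto
    moreover have "g 0 F \<in> poly_comp (c - - label X F)" for F
    proof (cases "F \<in> faces X - X_U X")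
      case True
      have "g 0 F \<in> poly_comp (c - - ?lt 0 F)"
        using g(1)[of 0] unfolding hcomp_face_module by blast
      then show ?thesis by (simp only: pos[OF True])
    next
      case False
      then have "g 0 F = 0" using zero gc[of 0] by (cases "F \<in> faces X") auto
      then show ?thesis by (simp add: poly_comp_0)
    qed
    ultimately show ?thesis unfolding hcomp_face_module by blast
  qed
  moreover have "s = (\<lambda>t. ?f (g 0))"
  proof
    fix t
    show "s t = ?f (g 0)" using g(2)[of t] const[of t] by simp
  qed
  ultimately show "s \<in> ?L" by blast
qed

lemma limit_module_duals_iso:
  fixes X :: "('p, 'n::finite) cell_complex"
  assumes fin: "finite (faces X)" and nn: "\<forall>F \<in> faces X. 0 \<le> label X F"
  shows "graded_iso (face_module (opposite X) (faces X - X_U X) (\<lambda>F. - label X F) i :: ('n, 'k::field, _) gmod)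
    (chain (limit_of_duals X) i) (\<lambda>g t. face_pairing X (faces X) (- i) g)"
proof -
  let ?lt = "\<lambda>t F. shift_label (const_vec t) (label X F)"
  let ?K = "face_module (opposite X) (faces X - X_U X) (\<lambda>F. - label X F) i :: ('n, 'k, _) gmod"
  let ?D = "\<lambda>t. dual_module (face_module X (faces X) (?lt t) (- i)) :: ('n, 'k, _) gmod"
  let ?\<phi> = "\<lambda>t t'. transition X (const_vec t) (const_vec t') i :: _ \<Rightarrow> _ \<Rightarrow> ('n, 'k) mpoly"
  let ?f = "face_pairing X (faces X) (- i) :: _ \<Rightarrow> _ \<Rightarrow> ('n, 'k) mpoly"
  have L: "chain (limit_of_duals X) i = limit_module ?D ?\<phi>"
    by (simp add: limit_of_duals_def shifted_dual_def shifted_complex_def)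
  have finQ: "finite (faces X - X_U X)" using fin by simp
  have hc: "(\<lambda>g t. ?f g) ` hcomp ?K c = limit_comp ?D ?\<phi> c" for c
    by (rule limit_comp_duals[OF fin nn])
  have Kc: "x \<in> face_coeffs X (faces X) (- i)" if "x \<in> carrier ?K" for x
    using that unfolding carrier_face_module_opposite by auto
  have Kh: "x \<in> carrier ?K" if "x \<in> hcomp ?K c" for x c
    using that unfolding hcomp_face_module by blast
  have iso: "graded_iso (face_module (opposite X) (faces X) (\<lambda>F. - ?lt t F) i) (?D t) ?f" for t
    by (rule face_pairing_iso[OF fin])
  have inj: "inj_on (\<lambda>g (t::nat). ?f g) (carrier ?K)"
  proof (rule inj_onI)
    fix x y assume "x \<in> carrier ?K" "y \<in> carrier ?K" "(\<lambda>t::nat. ?f x) = (\<lambda>t. ?f y)"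
    then show "x = y" using face_pairing_inj[OF fin Kc Kc] by metis
  qed
  have car: "(\<lambda>g t. ?f g) ` carrier ?K = carrier (limit_module ?D ?\<phi>)"
  proof (intro equalityI subsetI)
    fix s assume "s \<in> (\<lambda>g (t::nat). ?f g) ` carrier ?K"
    then obtain g where g: "g \<in> carrier ?K" and s: "s = (\<lambda>t. ?f g)" by blast
    let ?p = "face_part (\<lambda>F. - label X F) g" and ?S = "{c. face_part (\<lambda>F. - label X F) g c \<noteq> 0}"
    have finS: "finite ?S" and sum: "sum ?p ?S = g"
      using face_module_decomposition[OF finQ g] by auto
    have p: "?p c \<in> hcomp ?K c" for c by (rule face_part_hcomp[OF g])
    have "finsum (?D t) (\<lambda>c. ?f (?p c)) ?S = ?f g" for t
    proof -
      have "?p \<in> ?S \<rightarrow> face_coeffs X (faces X) (- i)" using p Kh Kc by blast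
      from finsum_face_pairing[OF fin finS this] show ?thesis by (simp only: sum)
    qed
    moreover have "(\<lambda>t. ?f (?p c)) \<in> limit_comp ?D ?\<phi> c" for c
      unfolding hc[symmetric] by (rule image_eqI[where x = "?p c"], rule refl, rule p)
    ultimately show "s \<in> carrier (limit_module ?D ?\<phi>)"
      unfolding limit_module_simps(1) mem_Collect_eq s using finS
      by (intro exI[of _ ?S] exI[of _ "\<lambda>c t. ?f (?p c)"]) simp
  next
    fix s assume "s \<in> carrier (limit_module ?D ?\<phi>)"
    then obtain A h where A: "finite A" and h: "\<forall>c\<in>A. h c \<in> limit_comp ?D ?\<phi> c"
      and s: "s = (\<lambda>t. finsum (?D t) (\<lambda>c. h c t) A)"
      unfolding limit_module_simps(1) by blast
    have "\<forall>c\<in>A. h c \<in> (\<lambda>g t. ?f g) ` hcomp ?K c" using h unfolding hc .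
    then have "\<forall>c\<in>A. \<exists>g. g \<in> hcomp ?K c \<and> h c = (\<lambda>t. ?f g)" by blast
    then obtain g where g: "\<forall>c\<in>A. g c \<in> hcomp ?K c \<and> h c = (\<lambda>t. ?f (g c))" by metis
    have gA: "g \<in> A \<rightarrow> face_coeffs X (faces X) (- i)" using g Kh Kc by blast
    have "s t = ?f (sum g A)" for t
    proof -
      interpret D: abelian_group "?D t" by (rule graded_iso_abelian_group[OF iso])
      have "?f (g c) \<in> carrier (?D t)" if "c \<in> A" for c
        using iso[of t] gA that unfolding graded_iso_def bij_betw_def carrier_face_module_opposite by blast
      then have "finsum (?D t) (\<lambda>c. h c t) A = finsum (?D t) (\<lambda>c. ?f (g c)) A"
        using g by (intro D.finsum_cong') auto
      also have "\<dots> = ?f (sum g A)"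
        by (rule finsum_face_pairing[OF fin A gA])
      finally show ?thesis unfolding s .
    qed
    moreover have "sum g A \<in> carrier ?K"
    proof -
      have "g c \<in> carrier ?K" if "c \<in> A" for c using g Kh that by blast
      then show ?thesis
        unfolding carrier_face_module_opposite mem_Collect_eq sum_apply_fun by (auto intro!: sum.neutral)
    qed
    ultimately show "s \<in> (\<lambda>g t. ?f g) ` carrier ?K" by blast
  qed
  have add: "?f (x \<oplus>\<^bsub>?K\<^esub> y) = ?f x \<oplus>\<^bsub>?D t\<^esub> ?f y" for x y t
    by (auto simp: face_pairing_def fun_eq_iff distrib_right sum.distrib)
  have smult: "?f (p \<odot>\<^bsub>?K\<^esub> x) = p \<odot>\<^bsub>?D t\<^esub> ?f x" for p x t
    by (auto simp: face_pairing_def fun_eq_iff sum_distrib_left mult.assoc)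
  have zero: "?f \<zero>\<^bsub>?K\<^esub> = \<zero>\<^bsub>?D t\<^esub>" for t
    by (auto simp: face_pairing_def fun_eq_iff)
  have gr: "is_graded_module ?K" by (rule face_module_graded[OF finQ])
  show ?thesis
    unfolding graded_iso_def bij_betw_def L limit_module_simps(2-5)
  proof (intro conjI ballI allI)
    show "(\<lambda>t. ?f \<zero>\<^bsub>?K\<^esub>) = (\<lambda>t. \<zero>\<^bsub>?D t\<^esub>)" by (rule ext, rule zero)
    show "(\<lambda>t. ?f (x \<oplus>\<^bsub>?K\<^esub> y)) = (\<lambda>t. ?f x \<oplus>\<^bsub>?D t\<^esub> ?f y)" for x y by (rule ext, rule add)
    show "(\<lambda>t. ?f (p \<odot>\<^bsub>?K\<^esub> x)) = (\<lambda>t. p \<odot>\<^bsub>?D t\<^esub> ?f x)" for p x by (rule ext, rule smult)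
  qed (fact gr inj car hc)+
qed

text \<open>The boundary maps agree with that of the model because, for a chain supported outside \<open>X_U\<close>, the
coboundary is supported there too, and on these faces shifting does not change the labels.\<close>

lemma limit_of_duals_iso:
  fixes X :: "('p, 'n::finite) cell_complex"
  assumes X: "labelled_regular_cell_complex X" and nn: "\<forall>F \<in> faces X. 0 \<le> label X F"
  shows "complex_iso (face_complex (opposite X) (faces X - X_U X) (\<lambda>F. - label X F) :: ('n, 'k::field, _) gcpx)
    (limit_of_duals X) (\<lambda>i g t. face_pairing X (faces X) (- i) g)"
proof -
  let ?lt = "\<lambda>t F. shift_label (const_vec t) (label X F)"
  let ?Q = "faces X - X_U X"
  let ?K = "face_complex (opposite X) ?Q (\<lambda>F. - label X F) :: ('n, 'k, _) gcpx"
  let ?f = "face_pairing X (faces X) :: _ \<Rightarrow> _ \<Rightarrow> _ \<Rightarrow> ('n, 'k) mpoly"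
  have fin: "finite (faces X)"
    using X by (auto simp: labelled_regular_cell_complex_def regular_cell_complex_def)
  have mono: "label X G \<le> label X F" if "F \<in> faces X" "G \<in> faces X" "incidence X F G \<noteq> 0" for F G
    using label_incidence_mono[OF X nn that] .
  have up: "F \<in> ?Q" if "F \<in> faces X" "G \<in> ?Q" "incidence X F G \<noteq> 0" for F G
    using mono[of F G] that by (auto simp: X_U_def)
  have gi: "graded_incidence X (faces X) (label X)"
    by (rule graded_incidence_faces[OF X mono])
  have giQ: "graded_incidence X ?Q (label X)"
    by (rule graded_incidence_diff[OF gi]) (use mono in \<open>auto simp: X_U_def dest: order_trans\<close>)
  \<comment> \<open>The shifted labels are still monotone along incidences, so each stage is a graded complex.\<close>
  have git: "graded_incidence X (faces X) (?lt t)" for t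
    by (rule graded_incidence_faces[OF X]) (rule shift_label_mono, simp add: le_fun_def, rule mono)
  have pos: "shift_label b (label X F) = label X F" if "F \<in> ?Q" for b F
    using that by (intro shift_label_positive) (simp add: X_U_def)
  have bd: "bdry (face_complex (opposite X) (faces X) (\<lambda>F. - ?lt t F)) i g = bdry ?K i g"
    if g: "g \<in> face_coeffs X ?Q (- i)" for t i and g :: "'p set \<Rightarrow> ('n, 'k) mpoly"
  proof
    fix F
    have gQ: "g G = 0" if "G \<notin> ?Q" for G using g that by auto
    show "bdry (face_complex (opposite X) (faces X) (\<lambda>F. - ?lt t F)) i g F = bdry ?K i g F"
    proof (cases "F \<in> faces X")
      case False
      then show ?thesis by simp
    next
      case F: True
      have "(\<Sum>G \<in> {G \<in> faces X. fdim (opposite X) G = i}. g G * bdry_coeff (opposite X) (\<lambda>F. - ?lt t F) G F) =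
          (\<Sum>G \<in> {G \<in> ?Q. fdim (opposite X) G = i}. g G * bdry_coeff (opposite X) (\<lambda>F. - ?lt t F) G F)"
        by (rule sum.mono_neutral_right) (use fin gQ in auto)
      also have "\<dots> = (\<Sum>G \<in> {G \<in> ?Q. fdim (opposite X) G = i}.
          if F \<in> ?Q then g G * bdry_coeff (opposite X) (\<lambda>F. - label X F) G F else 0)"
      proof (rule sum.cong[OF refl])
        fix G assume "G \<in> {G \<in> ?Q. fdim (opposite X) G = i}"
        then have G: "G \<in> ?Q" by blast
        show "g G * bdry_coeff (opposite X) (\<lambda>F. - ?lt t F) G F =
            (if F \<in> ?Q then g G * bdry_coeff (opposite X) (\<lambda>F. - label X F) G F else 0)"
        proof (cases "incidence X F G = 0")
          case False
          then have "F \<in> ?Q" using up F G by blast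
          then show ?thesis by (simp only: pos[OF G] pos[OF \<open>F \<in> ?Q\<close>] if_True)
        qed simp
      qed
      finally show ?thesis using F by (cases "F \<in> ?Q") simp_all
    qed
  qed
  have comm: "bdry (limit_of_duals X) i (\<lambda>t. ?f (- i) g) = (\<lambda>t. ?f (- (i - 1)) (bdry ?K i g))"
    if g: "g \<in> carrier (chain ?K i)" for i g
  proof
    fix t
    let ?C = "face_complex X (faces X) (?lt t) :: ('n, 'k, _) gcpx"
    have gQ: "g \<in> face_coeffs X ?Q (- i)"
      using g by (simp only: face_complex_simps(1) carrier_face_module_opposite)
    have "g \<in> carrier (chain (face_complex (opposite X) (faces X) (\<lambda>F. - ?lt t F)) i)"
      using gQ unfolding face_complex_simps(1) carrier_face_module_opposite by auto
    then have "bdry (dual_complex ?C) i (?f (- i) g) =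
        ?f (- (i - 1)) (bdry (face_complex (opposite X) (faces X) (\<lambda>F. - ?lt t F)) i g)"
      using face_pairing_complex_iso[OF git[of t], where 'k='k] unfolding complex_iso_def by metis
    also have "\<dots> = ?f (- (i - 1)) (bdry ?K i g)" by (simp only: bd[OF gQ])
    finally show "bdry (limit_of_duals X) i (\<lambda>t. ?f (- i) g) t = ?f (- (i - 1)) (bdry ?K i g)"
      unfolding limit_of_duals_def limit_complex_simps shifted_dual_def shifted_complex_def .
  qed
  show ?thesis
    unfolding complex_iso_def
  proof (intro conjI allI ballI)
    show "is_graded_complex ?K"
      by (rule face_complex_graded[OF graded_incidence_opposite[OF giQ]])
    show "graded_iso (chain ?K i) (chain (limit_of_duals X) i) (\<lambda>g t. ?f (- i) g)" for i
      unfolding face_complex_simps(1) by (rule limit_module_duals_iso[OF fin nn])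
  qed (rule comm[symmetric])
qed

section \<open>The isomorphism\<close>

theorem theorem6p9:
  fixes X :: "('p, 'n::finite) cell_complex"
  assumes "CARD('n) \<ge> 2"
    and "labelled_regular_cell_complex X"
    and "\<forall>F \<in> faces X. 0 \<le> label X F"
  shows "\<exists>\<phi>. graded_complex_iso
              (relative_dual_complex X (X_U X) ::
                 ('n, 'k::field, ('p set \<Rightarrow> ('n, 'k) mpoly) set \<Rightarrow> ('n, 'k) mpoly) gcpx)
              (limit_of_duals X) \<phi> \<and>
            (\<forall>F \<in> faces X - X_U X.
               \<phi> (- fdim X F) (relative_dual_basis X (X_U X) F) =
                 (\<lambda>t. shifted_dual_basis (const_vec t) X F))"
proof -
  let ?K = "face_complex (opposite X) (faces X - X_U X) (\<lambda>F. - label X F) :: ('n, 'k, _) gcpx"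
  let ?f = "face_pairing X (faces X) :: _ \<Rightarrow> _ \<Rightarrow> _ \<Rightarrow> ('n, 'k) mpoly"
  note X = assms(2) and nn = assms(3)
  have rX: "regular_cell_complex X" and fin: "finite (faces X)"
    using X by (auto simp: labelled_regular_cell_complex_def regular_cell_complex_def)
  have mono: "label X G \<le> label X F" if "F \<in> faces X" "G \<in> faces X" "incidence X F G \<noteq> 0" for F G
    using label_incidence_mono[OF X nn that] .
  have B: "graded_incidence X (faces X - {{}}) (label X)"
  proof (rule graded_incidence_diff[OF graded_incidence_faces[OF X mono]])
    fix F G :: "'p set"
    assume "F \<in> {{}}" "G \<in> faces X" "incidence X F G \<noteq> 0"
    moreover have "{} \<in> faces X" using rX by (simp add: regular_cell_complex_def)
    ultimately have "face_of X G {}"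
      using X by (auto simp: labelled_regular_cell_complex_def incidence_function_def)
    then show "G \<in> {{}}" by (simp add: face_of_def)
  qed
  have empty: "{} \<in> X_U X"
    using rX by (auto simp: X_U_def regular_cell_complex_def label_def le_fun_def)
  have sub: "X_U X \<subseteq> faces X" by (auto simp: X_U_def)
  have closed: "G \<in> X_U X" if "F \<in> X_U X" "G \<in> faces X" "incidence X F G \<noteq> 0" for F G
    using mono[of F G] that by (auto simp: X_U_def dest: order_trans)
  have "\<exists>\<psi>. complex_iso ?K (relative_dual_complex X (X_U X)) \<psi> \<and>
      (\<forall>F \<in> faces X - X_U X. \<psi> (- fdim X F) (face_vector F) = relative_dual_basis X (X_U X) F)"
    by (rule relative_dual_iso[OF B sub empty]) (erule (2) closed)
  then obtain \<psi> where \<psi>: "complex_iso ?K (relative_dual_complex X (X_U X)) \<psi>"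
    and \<psi>_basis: "\<forall>F \<in> faces X - X_U X. \<psi> (- fdim X F) (face_vector F) = relative_dual_basis X (X_U X) F"
    by (elim exE conjE) (rule that)
  define \<phi> where "\<phi> i u = (\<lambda>t::nat. ?f (- i) (inv_into (carrier (chain ?K i)) (\<psi> i) u))" for i u
  have "complex_iso (relative_dual_complex X (X_U X)) (limit_of_duals X) \<phi>"
    unfolding \<phi>_def using complex_iso_trans[OF complex_iso_sym[OF \<psi>] limit_of_duals_iso[OF X nn]] .
  then have "graded_complex_iso (relative_dual_complex X (X_U X)) (limit_of_duals X) \<phi>"
    by (rule complex_iso_imp_graded_complex_iso)
  moreover have "\<phi> (- fdim X F) (relative_dual_basis X (X_U X) F) =
      (\<lambda>t. shifted_dual_basis (const_vec t) X F)" if F: "F \<in> faces X - X_U X" for F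
  proof -
    have "inj_on (\<psi> (- fdim X F)) (carrier (chain ?K (- fdim X F)))"
      using \<psi> unfolding complex_iso_def graded_iso_def bij_betw_def by blast
    moreover have "face_vector F \<in> carrier (chain ?K (- fdim X F))"
      unfolding face_complex_simps(1) carrier_face_module_opposite minus_minus
      by (rule face_vector_in_face_coeffs[OF F refl])
    ultimately have "inv_into (carrier (chain ?K (- fdim X F))) (\<psi> (- fdim X F))
        (relative_dual_basis X (X_U X) F) = face_vector F"
      unfolding bspec[OF \<psi>_basis F, symmetric] by (rule inv_into_f_f)
    moreover have "F \<in> faces X" using F by simp
    ultimately show ?thesis
      unfolding \<phi>_def shifted_dual_basis_def shifted_complex_def
      by (simp only: minus_minus face_pairing_face_vector_left[OF fin _ refl]
          face_complex_simps(1) face_module_simps(1))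
  qed
  ultimately show ?thesis by blast
qed

end
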